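(* For every $n\in\mathbb{N}_0$, $$\lim_{\kappa\to0^+}\frac{E_n(\kappa)}{\kappa^2}=2n+1.$$
   Context: For $\kappa>0$, $H_\kappa=\Delta+v_\kappa$ is the self-adjoint operator on $\ell^2(\mathbb{Z})$ with $(\Delta f)(x)=2f(x)-f(x+1)-f(x-1)$ and $v_\kappa(x)=\kappa^4x^2$ acting as a multiplication operator; it has purely discrete spectrum. $E_n(\kappa)$ denotes its $n$-th eigenvalue counted with multiplicity, $n=0,1,2,\dots$. *)

theory Defs
  imports "HOL-Analysis.Analysis"
begin

definition ell2Z :: "(int \<Rightarrow> complex) set" where
  "ell2Z = {f. (\<lambda>x. (norm (f x))\<^sup>2) summable_on UNIV}"

definition H :: "real \<Rightarrow> (int \<Rightarrow> complex) \<Rightarrow> (int \<Rightarrow> complex)" where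
  "H \<kappa> f = (\<lambda>x. 2 * f x - f (x + 1) - f (x - 1) + complex_of_real (\<kappa> ^ 4 * (real_of_int x)\<^sup>2) * f x)"

text \<open>Eigenspace of H_kappa for lambda (inside l^2(Z); such f lie automatically in the operator domain).\<close>
definition eigenspace :: "real \<Rightarrow> real \<Rightarrow> (int \<Rightarrow> complex) set" where
  "eigenspace \<kappa> lam = {f. f \<in> ell2Z \<and> H \<kappa> f = (\<lambda>x. complex_of_real lam * f x)}"

definition is_eigenvalue :: "real \<Rightarrow> real \<Rightarrow> bool" where
  "is_eigenvalue \<kappa> lam \<longleftrightarrow> (\<exists>f\<in>eigenspace \<kappa> lam. f \<noteq> (\<lambda>_. 0))"

definition lin_indep :: "(int \<Rightarrow> complex) set \<Rightarrow> bool" where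
  "lin_indep S \<longleftrightarrow> finite S \<and>
     (\<forall>c. (\<forall>x. (\<Sum>g\<in>S. c g * g x) = 0) \<longrightarrow> (\<forall>g\<in>S. c g = 0))"

text \<open>Multiplicity = dimension of the eigenspace (finite here, since the spectrum is discrete).\<close>
definition multiplicity_ev :: "real \<Rightarrow> real \<Rightarrow> nat" where
  "multiplicity_ev \<kappa> lam = Sup {card S | S. S \<subseteq> eigenspace \<kappa> lam \<and> lin_indep S}"

definition count_ev :: "real \<Rightarrow> real \<Rightarrow> nat" where
  "count_ev \<kappa> lam = (\<Sum>\<mu>\<in>{\<mu>. is_eigenvalue \<kappa> \<mu> \<and> \<mu> \<le> lam}. multiplicity_ev \<kappa> \<mu>)"

text \<open>E_n(kappa): the n-th eigenvalue (n = 0,1,2,...) counted with multiplicity, in increasing order.\<close>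
definition E :: "nat \<Rightarrow> real \<Rightarrow> real" where
  "E n \<kappa> = (LEAST lam. n < count_ev \<kappa> lam)"

end

theory Submission
  imports Defs
begin

text \<open>
  An eigenvalue equation on \<open>\<int>\<close> is a second-order recurrence, so two square-summable solutions have
  vanishing Wronskian and every eigenvalue is simple: \<open>count_ev\<close> counts distinct eigenvalues.

  Few eigenvalues lie below \<open>(2n+1)\<kappa>\<^sup>2\<close>. A combination of \<open>n + 1\<close> eigenfunctions can be chosen
  nonzero with its piecewise linear interpolant \<open>F\<close> vanishing at the at most \<open>n\<close> zeros of the rescaled
  Hermite function. With \<open>w\<close> the logarithmic derivative of that function,
  \<open>F'\<^sup>2 + \<kappa>\<^sup>4y\<^sup>2F\<^sup>2 - (2n+1)\<kappa>\<^sup>2F\<^sup>2 - (F\<^sup>2w)' = (F' - Fw)\<^sup>2 \<ge> 0\<close>; integrating over the cells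
  \<open>[x, x + 1]\<close> and comparing the integrals of \<open>F\<^sup>2\<close> with lattice sums bounds the form of \<open>H\<close> from below
  by \<open>(2n+1)\<kappa>\<^sup>2 - O(\<kappa>\<^sup>4)\<close>.

  Conversely there is an eigenvalue within \<open>O(\<kappa>\<^sup>3)\<close> of each \<open>l = (2k+1)\<kappa>\<^sup>2\<close>. The minimum \<open>m\<close> of
  \<open>\<parallel>(H - l)f\<parallel>\<^sup>2\<close> over unit vectors is attained because the potential confines; the minimizer solves
  \<open>(H - l)\<^sup>2v = m v\<close>, so \<open>l + \<surd>m\<close> or \<open>l - \<surd>m\<close> is an eigenvalue, and sampling the \<open>k\<close>-th Hermite
  function at \<open>\<kappa>x\<close> gives \<open>m = O(\<kappa>\<^sup>6)\<close>.
\<close>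

section \<open>Square-summable functions on the integers and the real form of H\<close>

text \<open>Real sequences suffice: the coefficients of \<open>H\<close> are real, so real and
  imaginary parts of an eigenfunction solve the same equation.\<close>

definition lsq :: "(int \<Rightarrow> real) set" where
  "lsq = {f. (\<lambda>x. (f x)\<^sup>2) summable_on UNIV}"

definition ip :: "(int \<Rightarrow> real) \<Rightarrow> (int \<Rightarrow> real) \<Rightarrow> real" where
  "ip f g = (\<Sum>\<^sub>\<infinity>x. f x * g x)"

definition HR :: "real \<Rightarrow> (int \<Rightarrow> real) \<Rightarrow> (int \<Rightarrow> real)" where
  "HR \<kappa> f = (\<lambda>x. 2 * f x - f (x + 1) - f (x - 1) + \<kappa> ^ 4 * (real_of_int x)\<^sup>2 * f x)"

text \<open>The domain of the self-adjoint operator: the difference part is bounded, so only the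
  potential restricts it, and for \<kappa> > 0 the factor \<kappa>^4 does not affect the
  condition.\<close>

definition HR_dom :: "(int \<Rightarrow> real) set" where
  "HR_dom = {f \<in> lsq. (\<lambda>x. (real_of_int x)\<^sup>2 * f x) \<in> lsq}"

lemma summable_on_shift_int:
  fixes f :: "int \<Rightarrow> real"
  shows "(\<lambda>x. f (x + a)) summable_on UNIV \<longleftrightarrow> f summable_on UNIV"
  by (rule summable_on_reindex_bij_betw) (rule bij_betw_byWitness[where f' = "\<lambda>x. x - a"], auto)

lemma infsum_shift_int:
  fixes f :: "int \<Rightarrow> real"
  shows "(\<Sum>\<^sub>\<infinity>x. f (x + a)) = infsum f UNIV"
  by (rule infsum_reindex_bij_betw) (rule bij_betw_byWitness[where f' = "\<lambda>x. x - a"], auto)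

lemma lsq_dominated:
  assumes "f \<in> lsq" "\<And>x. \<bar>g x\<bar> \<le> C * \<bar>f x\<bar>"
  shows "g \<in> lsq"
proof -
  have "(\<lambda>x. C\<^sup>2 * (f x)\<^sup>2) summable_on UNIV"
    using assms(1) by (intro summable_on_cmult_right) (simp add: lsq_def)
  then have "(\<lambda>x. (g x)\<^sup>2) summable_on UNIV"
  proof (rule summable_on_comparison_test)
    show "(g x)\<^sup>2 \<le> C\<^sup>2 * (f x)\<^sup>2" for x
      using power_mono[OF assms(2)[of x], of 2] by (simp add: power_mult_distrib)
  qed auto
  then show ?thesis by (simp add: lsq_def)
qed

lemma lsq_zero: "(\<lambda>_. 0) \<in> lsq" by (simp add: lsq_def)

lemma lsq_cmult: "f \<in> lsq \<Longrightarrow> (\<lambda>x. c * f x) \<in> lsq"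
  by (rule lsq_dominated[where C = "\<bar>c\<bar>"]) (auto simp: abs_mult)

lemma lsq_mult_summable:
  assumes "f \<in> lsq" "g \<in> lsq"
  shows "(\<lambda>x. f x * g x) summable_on UNIV"
proof -
  have "(\<lambda>x. norm (f x * g x)) summable_on UNIV"
  proof (rule summable_on_comparison_test)
    show "(\<lambda>x. (f x)\<^sup>2 + (g x)\<^sup>2) summable_on UNIV"
      using assms by (intro summable_on_add) (auto simp: lsq_def)
    show "norm (f x * g x) \<le> (f x)\<^sup>2 + (g x)\<^sup>2" for x
    proof -
      have "(\<bar>f x\<bar> - \<bar>g x\<bar>)\<^sup>2 \<ge> 0" by simp
      then have "2 * (\<bar>f x\<bar> * \<bar>g x\<bar>) \<le> (f x)\<^sup>2 + (g x)\<^sup>2"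
        by (simp add: power2_diff)
      moreover have "\<bar>f x\<bar> * \<bar>g x\<bar> \<ge> 0" by simp
      ultimately show ?thesis unfolding real_norm_def abs_mult by linarith
    qed
  qed auto
  then show ?thesis by (rule abs_summable_summable)
qed

lemma lsq_add:
  assumes "f \<in> lsq" "g \<in> lsq"
  shows "(\<lambda>x. f x + g x) \<in> lsq"
proof -
  have "(\<lambda>x. (f x)\<^sup>2 + (g x)\<^sup>2 + 2 * (f x * g x)) summable_on UNIV"
    using assms lsq_mult_summable[OF assms]
    by (intro summable_on_add summable_on_cmult_right) (auto simp: lsq_def)
  then show ?thesis by (simp add: lsq_def power2_sum mult.assoc)
qed

lemma lsq_diff:
  assumes "f \<in> lsq" "g \<in> lsq"
  shows "(\<lambda>x. f x - g x) \<in> lsq"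
  using lsq_add[OF assms(1) lsq_cmult[OF assms(2), of "-1"]] by simp

lemma lsq_sum: "(\<And>i. i \<in> I \<Longrightarrow> f i \<in> lsq) \<Longrightarrow> (\<lambda>x. \<Sum>i\<in>I. f i x) \<in> lsq"
  by (induction I rule: infinite_finite_induct) (auto simp: lsq_zero lsq_add)

lemma lsq_shift: "f \<in> lsq \<Longrightarrow> (\<lambda>x. f (x + a)) \<in> lsq"
  using summable_on_shift_int[of "\<lambda>x. (f x)\<^sup>2" a] by (simp add: lsq_def)

lemma lsq_shift_minus: "f \<in> lsq \<Longrightarrow> (\<lambda>x. f (x - a)) \<in> lsq"
  using lsq_shift[of f "-a"] by simp

lemma ip_commute: "ip f g = ip g f"
  by (simp add: ip_def mult.commute)

lemma ip_add_left:
  assumes "f \<in> lsq" "g \<in> lsq" "h \<in> lsq"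
  shows "ip (\<lambda>x. f x + g x) h = ip f h + ip g h"
  unfolding ip_def distrib_right using assms
  by (intro infsum_add lsq_mult_summable)

lemma ip_cmult_left: "ip (\<lambda>x. c * f x) h = c * ip f h"
  unfolding ip_def by (simp add: mult.assoc infsum_cmult_right')

lemma ip_add_right:
  assumes "f \<in> lsq" "g \<in> lsq" "h \<in> lsq"
  shows "ip h (\<lambda>x. f x + g x) = ip h f + ip h g"
  using ip_add_left[OF assms] by (simp add: ip_commute)

lemma ip_cmult_right: "ip h (\<lambda>x. c * f x) = c * ip h f"
  using ip_cmult_left[of c f h] by (simp add: ip_commute)

lemma ip_sum_left:
  assumes "\<And>i. i \<in> I \<Longrightarrow> f i \<in> lsq" "h \<in> lsq"
  shows "ip (\<lambda>x. \<Sum>i\<in>I. f i x) h = (\<Sum>i\<in>I. ip (f i) h)"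
  using assms
proof (induction I rule: infinite_finite_induct)
  case (insert i I)
  then show ?case by (simp add: ip_add_left lsq_sum)
qed (auto simp: ip_def)

lemma ip_sum_right:
  assumes "\<And>i. i \<in> I \<Longrightarrow> f i \<in> lsq" "h \<in> lsq"
  shows "ip h (\<lambda>x. \<Sum>i\<in>I. f i x) = (\<Sum>i\<in>I. ip h (f i))"
  using ip_sum_left[of I f h] assms by (simp add: ip_commute)

lemma ip_self_pos:
  assumes "f \<in> lsq" "f x \<noteq> 0"
  shows "ip f f > 0"
proof -
  have "sum (\<lambda>x. f x * f x) {x} \<le> ip f f"
    unfolding ip_def using assms by (intro finite_sum_le_infsum lsq_mult_summable) auto
  moreover have "f x * f x > 0" using assms by (simp add: zero_less_mult_iff linorder_neq_iff disj_commute)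
  ultimately show ?thesis by simp
qed

lemma ip_self_nonneg: "ip f f \<ge> 0"
  unfolding ip_def by (intro infsum_nonneg) auto

lemma HR_dom_lsq: "f \<in> HR_dom \<Longrightarrow> f \<in> lsq"
  by (simp add: HR_dom_def)

text \<open>The square of x f(x) is the product of the square-summable functions f(x) and x^2
  f(x).\<close>

lemma HR_dom_x:
  assumes "f \<in> HR_dom"
  shows "(\<lambda>x. real_of_int x * f x) \<in> lsq"
proof -
  have "(\<lambda>x. f x * ((real_of_int x)\<^sup>2 * f x)) summable_on UNIV"
    using assms by (intro lsq_mult_summable) (auto simp: HR_dom_def)
  then show ?thesis by (simp add: lsq_def power2_eq_square algebra_simps)
qed

lemma HR_dom_cmult: "f \<in> HR_dom \<Longrightarrow> (\<lambda>x. c * f x) \<in> HR_dom"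
  using lsq_cmult[of f c] lsq_cmult[of "\<lambda>x. (real_of_int x)\<^sup>2 * f x" c]
  by (simp add: HR_dom_def mult.left_commute)

lemma HR_dom_add: "f \<in> HR_dom \<Longrightarrow> g \<in> HR_dom \<Longrightarrow> (\<lambda>x. f x + g x) \<in> HR_dom"
  using lsq_add[of f g] lsq_add[of "\<lambda>x. (real_of_int x)\<^sup>2 * f x" "\<lambda>x. (real_of_int x)\<^sup>2 * g x"]
  by (simp add: HR_dom_def distrib_left)

lemma HR_dom_zero: "(\<lambda>_. 0) \<in> HR_dom"
  by (simp add: HR_dom_def lsq_zero)

lemma HR_dom_sum: "(\<And>i. i \<in> I \<Longrightarrow> f i \<in> HR_dom) \<Longrightarrow> (\<lambda>x. \<Sum>i\<in>I. f i x) \<in> HR_dom"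
  by (induction I rule: infinite_finite_induct) (auto simp: HR_dom_zero HR_dom_add)

lemma HR_lsq:
  assumes "f \<in> HR_dom"
  shows "HR \<kappa> f \<in> lsq"
proof -
  have "f \<in> lsq" "(\<lambda>x. (real_of_int x)\<^sup>2 * f x) \<in> lsq" using assms by (auto simp: HR_dom_def)
  then show ?thesis
    unfolding HR_def mult.assoc by (intro lsq_add lsq_diff lsq_cmult lsq_shift lsq_shift_minus)
qed

lemma HR_add: "HR \<kappa> (\<lambda>x. f x + g x) = (\<lambda>x. HR \<kappa> f x + HR \<kappa> g x)"
  by (simp add: HR_def fun_eq_iff algebra_simps)

lemma HR_cmult: "HR \<kappa> (\<lambda>x. c * f x) = (\<lambda>x. c * HR \<kappa> f x)"
  by (simp add: HR_def fun_eq_iff algebra_simps)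

lemma HR_zero: "HR \<kappa> (\<lambda>_. 0) = (\<lambda>_. 0)"
  by (simp add: HR_def)

lemma HR_sum: "HR \<kappa> (\<lambda>x. \<Sum>i\<in>I. f i x) = (\<lambda>x. \<Sum>i\<in>I. HR \<kappa> (f i) x)"
  by (induction I rule: infinite_finite_induct) (auto simp: HR_add HR_zero)

text \<open>Summation by parts. The right-hand side is symmetric in \<open>f\<close> and
  \<open>g\<close>, which yields the symmetry of \<open>HR\<close>.\<close>

lemma ip_HR:
  assumes f: "f \<in> HR_dom" and g: "g \<in> HR_dom"
  shows "ip (HR \<kappa> f) g = (\<Sum>\<^sub>\<infinity>x. (f (x + 1) - f x) * (g (x + 1) - g x))
           + \<kappa> ^ 4 * (\<Sum>\<^sub>\<infinity>x. (real_of_int x * f x) * (real_of_int x * g x))"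
proof -
  have fl: "f \<in> lsq" and gl: "g \<in> lsq" using f g by (auto simp: HR_dom_def)
  note sh = lsq_shift[OF fl, of 1] lsq_shift[OF gl, of 1] lsq_shift_minus[OF fl, of 1] lsq_shift_minus[OF gl, of 1]
  \<comment> \<open>The second difference splits into a forward difference, giving \<open>b\<close>,
    and a backward one, giving \<open>c\<close> shifted by one site. After undoing the shift,
    \<open>b + c = a\<close>.\<close>
  define a b where "a = (\<lambda>x. (f (x + 1) - f x) * (g (x + 1) - g x))"
    and "b = (\<lambda>x. (f x - f (x + 1)) * g x)"
  define c where "c = (\<lambda>x. (f (x + 1) - f x) * g (x + 1))"
  define d where "d = (\<lambda>x. (real_of_int x * f x) * (real_of_int x * g x))"
  have sb: "b summable_on UNIV" and sc: "c summable_on UNIV" and sd: "d summable_on UNIV"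
    unfolding b_def c_def d_def
    using fl gl sh HR_dom_x[OF f] HR_dom_x[OF g] by (auto intro!: lsq_mult_summable lsq_diff)
  have scs: "(\<lambda>x. c (x + (-1))) summable_on UNIV" using sc by (subst summable_on_shift_int)
  have "ip (HR \<kappa> f) g = (\<Sum>\<^sub>\<infinity>x. (b x + c (x + (-1))) + \<kappa> ^ 4 * d x)"
    unfolding ip_def by (intro infsum_cong) (simp add: HR_def b_def c_def d_def algebra_simps power2_eq_square)
  also have "\<dots> = (\<Sum>\<^sub>\<infinity>x. b x + c (x + (-1))) + (\<Sum>\<^sub>\<infinity>x. \<kappa> ^ 4 * d x)"
    using sb scs sd by (intro infsum_add summable_on_add summable_on_cmult_right)
  also have "(\<Sum>\<^sub>\<infinity>x. b x + c (x + (-1))) = infsum b UNIV + (\<Sum>\<^sub>\<infinity>x. c (x + (-1)))"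
    using sb scs by (intro infsum_add)
  also have "(\<Sum>\<^sub>\<infinity>x. c (x + (-1))) = infsum c UNIV" by (rule infsum_shift_int)
  also have "infsum b UNIV + infsum c UNIV = (\<Sum>\<^sub>\<infinity>x. b x + c x)"
    using sb sc by (intro infsum_add[symmetric])
  also have "\<dots> = infsum a UNIV"
    by (intro infsum_cong) (simp add: a_def b_def c_def algebra_simps)
  finally show ?thesis by (simp add: a_def d_def infsum_cmult_right')
qed

lemma ip_HR_commute:
  assumes "f \<in> HR_dom" "g \<in> HR_dom"
  shows "ip (HR \<kappa> f) g = ip f (HR \<kappa> g)"
proof -
  have "ip (HR \<kappa> f) g = ip (HR \<kappa> g) f"
    unfolding ip_HR[OF assms] ip_HR[OF assms(2,1)] by (simp add: mult.commute)
  then show ?thesis by (simp add: ip_commute)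
qed

section \<open>Real eigenfunctions and their relation to the complex eigenspaces\<close>

definition HR_ev :: "real \<Rightarrow> real \<Rightarrow> (int \<Rightarrow> real) \<Rightarrow> bool" where
  "HR_ev \<kappa> lam f \<longleftrightarrow> f \<in> lsq \<and> (\<exists>x. f x \<noteq> 0) \<and> (\<forall>x. HR \<kappa> f x = lam * f x)"

text \<open>The eigenvalue equation expresses \<kappa>^4 x^2 f(x) through f and its two neighbouring
  shifts, all of which are square-summable.\<close>

lemma HR_ev_dom:
  assumes "\<kappa> > 0" "HR_ev \<kappa> lam f"
  shows "f \<in> HR_dom"
proof -
  have f: "f \<in> lsq" and e: "\<And>x. HR \<kappa> f x = lam * f x"
    using assms(2) by (auto simp: HR_ev_def)
  have "(\<lambda>x. (1 / \<kappa> ^ 4) * ((lam - 2) * f x + f (x + 1) + f (x - 1))) \<in> lsq"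
    using f by (intro lsq_add lsq_diff lsq_cmult lsq_shift lsq_shift_minus)
  also have "(\<lambda>x. (1 / \<kappa> ^ 4) * ((lam - 2) * f x + f (x + 1) + f (x - 1))) = (\<lambda>x. (real_of_int x)\<^sup>2 * f x)"
  proof
    fix x
    have "2 * f x - f (x + 1) - f (x - 1) + \<kappa> ^ 4 * (real_of_int x)\<^sup>2 * f x = lam * f x"
      using e[of x] by (simp add: HR_def)
    then have "(lam - 2) * f x + f (x + 1) + f (x - 1) = \<kappa> ^ 4 * ((real_of_int x)\<^sup>2 * f x)"
      by (simp add: algebra_simps)
    then show "(1 / \<kappa> ^ 4) * ((lam - 2) * f x + f (x + 1) + f (x - 1)) = (real_of_int x)\<^sup>2 * f x"
      using assms(1) by simp
  qed
  finally show ?thesis using f by (simp add: HR_dom_def)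
qed

lemma HR_ev_orthogonal:
  assumes "\<kappa> > 0" "HR_ev \<kappa> lam f" "HR_ev \<kappa> mu g" "lam \<noteq> mu"
  shows "ip f g = 0"
proof -
  have e: "HR \<kappa> f = (\<lambda>x. lam * f x)" "HR \<kappa> g = (\<lambda>x. mu * g x)"
    using assms(2,3) by (simp_all add: HR_ev_def fun_eq_iff)
  have "lam * ip f g = ip (HR \<kappa> f) g" unfolding e by (rule ip_cmult_left[symmetric])
  also have "\<dots> = ip f (HR \<kappa> g)"
    by (rule ip_HR_commute[OF HR_ev_dom[OF assms(1,2)] HR_ev_dom[OF assms(1,3)]])
  also have "\<dots> = mu * ip f g" unfolding e by (rule ip_cmult_right)
  finally show ?thesis using assms(4) by simp
qed

lemma eigenspace_real_parts:
  assumes "f \<in> eigenspace \<kappa> lam"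
  shows "(\<lambda>x. Re (f x)) \<in> lsq" "HR \<kappa> (\<lambda>x. Re (f x)) x = lam * Re (f x)"
    "(\<lambda>x. Im (f x)) \<in> lsq" "HR \<kappa> (\<lambda>x. Im (f x)) x = lam * Im (f x)"
proof -
  have s: "(\<lambda>x. (norm (f x))\<^sup>2) summable_on UNIV"
    using assms by (simp add: eigenspace_def ell2Z_def)
  have e: "H \<kappa> f x = complex_of_real lam * f x"
    using assms by (simp add: eigenspace_def fun_eq_iff)
  have n: "(\<lambda>x. norm (f x)) \<in> lsq" using s by (simp add: lsq_def)
  show "(\<lambda>x. Re (f x)) \<in> lsq" "(\<lambda>x. Im (f x)) \<in> lsq"
    by (rule lsq_dominated[OF n, where C = 1], simp add: abs_Re_le_cmod abs_Im_le_cmod)+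
  show "HR \<kappa> (\<lambda>x. Re (f x)) x = lam * Re (f x)"
    using arg_cong[OF e, of Re] by (simp add: HR_def H_def del: of_real_mult of_real_power)
  show "HR \<kappa> (\<lambda>x. Im (f x)) x = lam * Im (f x)"
    using arg_cong[OF e, of Im] by (simp add: HR_def H_def del: of_real_mult of_real_power)
qed

text \<open>A nonzero complex eigenfunction has a nonzero real or imaginary part, which is a real
  eigenfunction; conversely a real one is embedded.\<close>

lemma is_eigenvalue_iff_HR_ev: "is_eigenvalue \<kappa> lam \<longleftrightarrow> (\<exists>f. HR_ev \<kappa> lam f)"
proof
  assume "is_eigenvalue \<kappa> lam"
  then obtain f x where f: "f \<in> eigenspace \<kappa> lam" "f x \<noteq> 0"
    unfolding is_eigenvalue_def by blast
  then have "Re (f x) \<noteq> 0 \<or> Im (f x) \<noteq> 0" by (auto simp: complex_eq_iff)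
  then have "HR_ev \<kappa> lam (\<lambda>x. Re (f x)) \<or> HR_ev \<kappa> lam (\<lambda>x. Im (f x))"
    using eigenspace_real_parts[OF f(1)] by (auto simp: HR_ev_def)
  then show "\<exists>f. HR_ev \<kappa> lam f" by blast
next
  assume "\<exists>f. HR_ev \<kappa> lam f"
  then obtain f x where f: "f \<in> lsq" "f x \<noteq> 0" "\<And>x. HR \<kappa> f x = lam * f x" by (auto simp: HR_ev_def)
  define g where "g = (\<lambda>x. complex_of_real (f x))"
  have "H \<kappa> g x = complex_of_real (HR \<kappa> f x)" for x
    by (simp add: H_def HR_def g_def)
  then have "H \<kappa> g = (\<lambda>x. complex_of_real lam * g x)" by (simp add: f(3) g_def fun_eq_iff)
  moreover have "g \<in> ell2Z" using f(1) by (simp add: ell2Z_def lsq_def g_def)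
  ultimately have "g \<in> eigenspace \<kappa> lam" unfolding eigenspace_def by blast
  moreover have "g x \<noteq> 0" using f(2) by (simp add: g_def)
  then have "g \<noteq> (\<lambda>_. 0)" by metis
  ultimately show "is_eigenvalue \<kappa> lam" unfolding is_eigenvalue_def by blast
qed

section \<open>Lower bound for the quadratic form\<close>

text \<open>The physicists' Hermite polynomials, generated by the raising operator 2s -
  d/ds.\<close>

fun hermite :: "nat \<Rightarrow> real poly" where
  "hermite 0 = 1"
| "hermite (Suc n) = [:0, 2:] * hermite n - pderiv (hermite n)"

text \<open>Differentiation is the lowering operator. In the inductive step, the induction
  hypothesis turns the derivative of the recursion into multiples of 2s H_n - H_n', which is again
  the raising operator.\<close>

lemma pderiv_hermite: "pderiv (hermite (Suc n)) = smult (2 * real (Suc n)) (hermite n)"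
proof (induction n)
  case (Suc n)
  have "hermite (Suc (Suc n)) = [:0, 2:] * hermite (Suc n) - smult (2 * real (Suc n)) (hermite n)"
    using Suc by (simp only: hermite.simps(2)[of "Suc n"])
  then have "pderiv (hermite (Suc (Suc n))) = smult 2 (hermite (Suc n)) + [:0, 2:] * pderiv (hermite (Suc n))
      - smult (2 * real (Suc n)) (pderiv (hermite n))"
    by (simp only: pderiv_diff pderiv_mult pderiv_smult) (simp add: pderiv_pCons)
  also have "\<dots> = smult 2 (hermite (Suc n)) + smult (2 * real (Suc n)) (hermite (Suc n))"
    unfolding Suc by (simp add: algebra_simps smult_diff_right)
  also have "\<dots> = smult (2 * real (Suc (Suc n))) (hermite (Suc n))"
    unfolding smult_add_left[symmetric] by (simp add: algebra_simps)
  finally show ?case .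
qed (simp add: pderiv_pCons pderiv_1)

lemma hermite_Suc_Suc:
  "hermite (Suc (Suc n)) = [:0, 2:] * hermite (Suc n) - smult (2 * real (Suc n)) (hermite n)"
  by (simp only: hermite.simps(2)[of "Suc n"] pderiv_hermite)

text \<open>Lowering by d/ds and then raising by 2s - d/ds multiplies \<open>hermite n\<close> by
  2n.\<close>

lemma hermite_ode:
  "poly (pderiv (pderiv (hermite n))) s - 2 * s * poly (pderiv (hermite n)) s + 2 * real n * poly (hermite n) s = 0"
proof (cases n)
  case (Suc m)
  have "poly (hermite (Suc m)) s = 2 * s * poly (hermite m) s - poly (pderiv (hermite m)) s"
    by simp
  then show ?thesis
    unfolding Suc pderiv_hermite pderiv_smult poly_smult
    by (simp only:) (simp add: algebra_simps del: hermite.simps)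
qed (simp add: pderiv_1)

lemma degree_hermite: "degree (hermite n) \<le> n"
proof (induction n)
  case (Suc n)
  have "degree ([:0, 2:] * hermite n) \<le> Suc n"
    using degree_mult_le[of "[:0, 2::real:]" "hermite n"] Suc by simp
  moreover have "degree (pderiv (hermite n)) \<le> Suc n"
    using Suc by (simp add: degree_pderiv)
  ultimately show ?case by (simp add: degree_diff_le)
qed simp

text \<open>A common zero of two consecutive polynomials would descend through the three-term
  recurrence to \<open>hermite 0 = 1\<close>.\<close>

lemma hermite_zero_step:
  "poly (hermite (Suc n)) s = 0 \<Longrightarrow> poly (hermite n) s \<noteq> 0"
proof (induction n)
  case (Suc n)
  show ?case
  proof
    assume a: "poly (hermite (Suc n)) s = 0"
    have "poly (hermite (Suc (Suc n))) s = 0" by (rule Suc.prems)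
    then have "poly (hermite n) s = 0" unfolding hermite_Suc_Suc
      using a by (simp del: hermite.simps)
    then show False using Suc.IH a by simp
  qed
qed simp

lemma hermite_nonzero: "hermite n \<noteq> 0"
proof (cases n)
  case (Suc m)
  show ?thesis
  proof
    assume "hermite n = 0"
    then have "hermite m = 0" "poly (hermite (Suc m)) 0 = 0"
      using pderiv_hermite[of m] by (simp_all add: Suc del: hermite.simps)
    then show False using hermite_zero_step[of m 0] by simp
  qed
qed simp

text \<open>The derivative is a nonzero multiple of the preceding polynomial, which shares no zero
  with this one.\<close>

lemma hermite_simple_zero:
  assumes "poly (hermite n) s = 0"
  shows "poly (pderiv (hermite n)) s \<noteq> 0"
proof (cases n)
  case (Suc m)
  then show ?thesis using hermite_zero_step[of m s] assms
    by (simp add: pderiv_hermite del: hermite.simps)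
qed (use assms in simp)

text \<open>For large |s| the term 2s H_(n+1) dominates the three-term recurrence. The threshold is
  what lets 2|s| exceed 2(n+1) by 2 in the inductive step.\<close>

lemma hermite_growth:
  assumes "real n + 1 \<le> \<bar>s\<bar>"
  shows "\<bar>poly (hermite n) s\<bar> \<le> \<bar>poly (hermite (Suc n)) s\<bar>"
  using assms
proof (induction n)
  case (Suc n)
  let ?p = "\<lambda>n. \<bar>poly (hermite n) s\<bar>"
  have IH: "?p n \<le> ?p (Suc n)" using Suc by simp
  have e: "poly (hermite (Suc (Suc n))) s = 2 * s * poly (hermite (Suc n)) s - 2 * real (Suc n) * poly (hermite n) s"
    unfolding hermite_Suc_Suc by (simp del: hermite.simps)
  have "?p (Suc (Suc n)) \<ge> \<bar>2 * s * poly (hermite (Suc n)) s\<bar> - \<bar>2 * real (Suc n) * poly (hermite n) s\<bar>"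
    unfolding e by linarith
  then have "?p (Suc (Suc n)) \<ge> 2 * \<bar>s\<bar> * ?p (Suc n) - 2 * real (Suc n) * ?p n"
    by (simp add: abs_mult del: hermite.simps)
  moreover have "2 * real (Suc n) * ?p n \<le> 2 * real (Suc n) * ?p (Suc n)"
    using IH by (intro mult_left_mono) auto
  moreover have "(2 * real (Suc n) + 2) * ?p (Suc n) \<le> 2 * \<bar>s\<bar> * ?p (Suc n)"
    using Suc.prems by (intro mult_right_mono) auto
  ultimately have "2 * ?p (Suc n) \<le> ?p (Suc (Suc n))" by (simp add: algebra_simps del: hermite.simps)
  then show ?case by (simp del: hermite.simps)
qed simp

lemma pderiv_hermite_bound:
  assumes "real n \<le> \<bar>s\<bar>"
  shows "\<bar>poly (pderiv (hermite n)) s\<bar> \<le> 2 * real n * \<bar>poly (hermite n) s\<bar>"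
proof (cases n)
  case (Suc m)
  have "\<bar>poly (hermite m) s\<bar> \<le> \<bar>poly (hermite (Suc m)) s\<bar>"
    using assms Suc by (intro hermite_growth) auto
  then show ?thesis unfolding Suc pderiv_hermite poly_smult
    by (simp add: abs_mult mult_left_mono del: hermite.simps)
qed (simp add: pderiv_1)

section \<open>The logarithmic derivative of the Hermite functions\<close>

text \<open>
  The logarithmic derivative of the Hermite function \<open>H\<^sub>n(s) exp(-s\<^sup>2/2)\<close>. At a zero of \<open>H\<^sub>n\<close> the
  division by zero yields the junk value \<open>-s\<close>, harmless below because it gets multiplied by 0.
\<close>

definition herm_dlog :: "nat \<Rightarrow> real \<Rightarrow> real" where
  "herm_dlog n s = poly (pderiv (hermite n)) s / poly (hermite n) s - s"

text \<open>If \<phi> is the Hermite function, then \<phi>'' = (s^2 - (2n+1)) \<phi>, and w =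
  \<phi>'/\<phi> satisfies w' = \<phi>''/\<phi> - w^2.\<close>

lemma herm_dlog_riccati:
  assumes "poly (hermite n) s \<noteq> 0"
  shows "(herm_dlog n has_real_derivative s\<^sup>2 - (2 * real n + 1) - (herm_dlog n s)\<^sup>2) (at s)"
proof -
  define p q r where "p = poly (hermite n) s" and "q = poly (pderiv (hermite n)) s"
    and "r = poly (pderiv (pderiv (hermite n))) s"
  have pn: "p \<noteq> 0" using assms by (simp add: p_def)
  have r: "r = 2 * s * q - 2 * real n * p" using hermite_ode[of n s] by (simp add: p_def q_def r_def)
  have "(herm_dlog n has_real_derivative (r * p - q * q) / (p * p) - 1) (at s)"
    unfolding herm_dlog_def p_def q_def r_def using assms
    by (auto intro!: derivative_eq_intros)
  also have "(r * p - q * q) / (p * p) - 1 = s\<^sup>2 - (2 * real n + 1) - (q / p - s)\<^sup>2"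
    unfolding r using pn by (simp add: field_simps power2_eq_square)
  finally show ?thesis by (simp add: herm_dlog_def[abs_def] p_def q_def)
qed

lemma herm_dlog_bound:
  assumes "real n \<le> \<bar>s\<bar>"
  shows "\<bar>herm_dlog n s\<bar> \<le> 2 * real n + \<bar>s\<bar>"
proof -
  have "\<bar>poly (pderiv (hermite n)) s / poly (hermite n) s\<bar> \<le> 2 * real n"
    using pderiv_hermite_bound[OF assms] unfolding abs_divide
    by (cases "poly (hermite n) s = 0") (auto simp: divide_le_eq)
  then show ?thesis unfolding herm_dlog_def by linarith
qed

text \<open>Zeros of \<open>hermite n\<close> are simple, so \<open>herm_dlog\<close> has only a
  simple pole there, while the squared linear function has a double zero. The product extends
  continuously, and its value at the zero is 0 whatever the division returns.\<close>

lemma herm_dlog_continuous_at_zero: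
  assumes \<kappa>: "\<kappa> > 0" and F: "poly (hermite n) (\<kappa> * y0) = 0 \<Longrightarrow> a + (y0 - x) * d = 0"
  shows "isCont (\<lambda>y. (a + (y - x) * d)\<^sup>2 * (\<kappa> * herm_dlog n (\<kappa> * y))) y0"
proof (cases "poly (hermite n) (\<kappa> * y0) = 0")
  case False
  then show ?thesis unfolding herm_dlog_def by (intro continuous_intros) auto
next
  case True
  obtain g where g: "hermite n = [:- (\<kappa> * y0), 1:] * g"
    using True unfolding poly_eq_0_iff_dvd by (rule dvdE)
  have g0: "poly g (\<kappa> * y0) \<noteq> 0"
  proof -
    have "pderiv (hermite n) = g + [:- (\<kappa> * y0), 1:] * pderiv g"
      unfolding g pderiv_mult by (simp add: pderiv_pCons)
    then have "poly (pderiv (hermite n)) (\<kappa> * y0) = poly g (\<kappa> * y0)" by simp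
    then show ?thesis using hermite_simple_zero[OF True] by simp
  qed
  have e: "a + (y - x) * d = d * (y - y0)" for y using F[OF True] by (simp add: algebra_simps)
  have "(\<lambda>y. (a + (y - x) * d)\<^sup>2 * (\<kappa> * herm_dlog n (\<kappa> * y)))
    = (\<lambda>y. d\<^sup>2 * ((y - y0) * poly (pderiv (hermite n)) (\<kappa> * y) / poly g (\<kappa> * y) - (y - y0)\<^sup>2 * \<kappa> * (\<kappa> * y)))"
  proof
    fix y
    have h: "poly (hermite n) (\<kappa> * y) = \<kappa> * (y - y0) * poly g (\<kappa> * y)"
      unfolding g by (simp add: algebra_simps)
    show "(a + (y - x) * d)\<^sup>2 * (\<kappa> * herm_dlog n (\<kappa> * y))
      = d\<^sup>2 * ((y - y0) * poly (pderiv (hermite n)) (\<kappa> * y) / poly g (\<kappa> * y) - (y - y0)\<^sup>2 * \<kappa> * (\<kappa> * y))"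
      unfolding e herm_dlog_def h using \<kappa>
      by (cases "poly g (\<kappa> * y) = 0"; cases "y = y0") (simp_all add: field_simps power2_eq_square)
  qed
  moreover have "isCont (\<lambda>y. d\<^sup>2 * ((y - y0) * poly (pderiv (hermite n)) (\<kappa> * y) / poly g (\<kappa> * y) - (y - y0)\<^sup>2 * \<kappa> * (\<kappa> * y))) y0"
    using g0 by (intro continuous_intros) auto
  ultimately show ?thesis by simp
qed

text \<open>
  Up to a nonnegative multiple of \<open>(b - a)\<^sup>2\<close>, the right-hand side minus the left-hand side is the
  integral over \<open>[x, x + 1]\<close> of \<open>(F' - F w)\<^sup>2\<close>, where \<open>F\<close> is the linear function with values
  \<open>a\<close>, \<open>b\<close> at the endpoints and \<open>w(y) = \<kappa> herm_dlog n (\<kappa>y)\<close>.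
\<close>

lemma cell_inequality:
  fixes x a b \<kappa> :: real
  assumes \<kappa>: "\<kappa> > 0"
    and F: "\<And>y. x \<le> y \<Longrightarrow> y \<le> x + 1 \<Longrightarrow> poly (hermite n) (\<kappa> * y) = 0 \<Longrightarrow> a + (y - x) * (b - a) = 0"
  defines "G \<equiv> \<lambda>y c. c\<^sup>2 * (\<kappa> * herm_dlog n (\<kappa> * y))"
  shows "G (x + 1) b - G x a \<le> (1 + (2 * real n + 1) * \<kappa>\<^sup>2 / 6) * (b - a)\<^sup>2
     + \<kappa> ^ 4 * (a\<^sup>2 * (x\<^sup>2 / 2 + x / 3 + 1 / 12) + b\<^sup>2 * ((x + 1)\<^sup>2 / 2 - (x + 1) / 3 + 1 / 12))
     - (2 * real n + 1) * \<kappa>\<^sup>2 * (a\<^sup>2 + b\<^sup>2) / 2"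
proof -
  define d N where "d = b - a" and "N = 2 * real n + 1"
  define F where "F = (\<lambda>y. a + (y - x) * d)"
  \<comment> \<open>These are the coefficients, in powers of t = y - x, of d^2 + \<kappa>^4 y^2 F^2
    - N \<kappa>^2 F^2; \<open>Q\<close> is the antiderivative that vanishes at t = 0.\<close>
  define c0 c1 c2 c3 c4 where
    "c0 = d\<^sup>2 + \<kappa> ^ 4 * x\<^sup>2 * a\<^sup>2 - N * \<kappa>\<^sup>2 * a\<^sup>2"
    and "c1 = \<kappa> ^ 4 * (2 * x\<^sup>2 * a * d + 2 * x * a\<^sup>2) - 2 * N * \<kappa>\<^sup>2 * a * d"
    and "c2 = \<kappa> ^ 4 * (x\<^sup>2 * d\<^sup>2 + 4 * x * a * d + a\<^sup>2) - N * \<kappa>\<^sup>2 * d\<^sup>2"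
    and "c3 = \<kappa> ^ 4 * (2 * x * d\<^sup>2 + 2 * a * d)"
    and "c4 = \<kappa> ^ 4 * d\<^sup>2"
  note c_defs = c0_def c1_def c2_def c3_def c4_def
  define Q where "Q = (\<lambda>t. c0 * t + c1 / 2 * t ^ 2 + c2 / 3 * t ^ 3 + c3 / 4 * t ^ 4 + c4 / 5 * t ^ 5)"
  define P where "P = (\<lambda>y. Q (y - x))"
  define K where "K = (\<lambda>y. P y - (F y)\<^sup>2 * (\<kappa> * herm_dlog n (\<kappa> * y)))"
  \<comment> \<open>At these finitely many points \<open>K\<close> is only shown to be continuous,
    which the fundamental theorem used below tolerates.\<close>
  define S where "S = (\<lambda>s. s / \<kappa>) ` {s. poly (hermite n) s = 0}"
  have "finite S" unfolding S_def by (intro finite_imageI poly_roots_finite hermite_nonzero)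
  have dP: "(P has_real_derivative d\<^sup>2 + \<kappa> ^ 4 * y\<^sup>2 * (F y)\<^sup>2 - N * \<kappa>\<^sup>2 * (F y)\<^sup>2) (at y)" for y
  proof -
    define t where "t = y - x"
    have "(Q has_real_derivative c0 + c1 * t + c2 * t ^ 2 + c3 * t ^ 3 + c4 * t ^ 4) (at t)"
      (is "(_ has_real_derivative ?D) _")
      unfolding Q_def by (auto intro!: derivative_eq_intros)
    then have "(P has_real_derivative ?D) (at y)"
      using DERIV_shift[of Q ?D y "-x"] by (simp add: P_def t_def[symmetric])
    moreover have "y = x + t" "F y = a + t * d" by (simp_all add: t_def F_def)
    then have "?D = d\<^sup>2 + \<kappa> ^ 4 * y\<^sup>2 * (F y)\<^sup>2 - N * \<kappa>\<^sup>2 * (F y)\<^sup>2"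
      unfolding c_defs by (simp add: algebra_simps power2_eq_square power3_eq_cube power4_eq_xxxx)
    ultimately show ?thesis by simp
  qed
  have contK: "continuous_on {x..x+1} K"
    unfolding K_def
  proof (intro continuous_on_diff continuous_at_imp_continuous_on ballI)
    fix y assume "y \<in> {x..x+1}"
    then show "isCont (\<lambda>y. (F y)\<^sup>2 * (\<kappa> * herm_dlog n (\<kappa> * y))) y"
      unfolding F_def d_def using F by (intro herm_dlog_continuous_at_zero \<kappa>) auto
    show "isCont P y" using dP by (rule DERIV_isCont)
  qed
  have dK: "(K has_real_derivative (d - F y * \<kappa> * herm_dlog n (\<kappa> * y))\<^sup>2) (at y)" if "y \<notin> S" for y
  proof -
    have nz: "poly (hermite n) (\<kappa> * y) \<noteq> 0"
      using that \<kappa> by (auto simp: S_def image_iff)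
    define w where "w = herm_dlog n (\<kappa> * y)"
    have dw: "((\<lambda>y. herm_dlog n (\<kappa> * y)) has_real_derivative ((\<kappa> * y)\<^sup>2 - N - w\<^sup>2) * \<kappa>) (at y)"
      unfolding w_def N_def by (rule DERIV_chain2[OF herm_dlog_riccati[OF nz] DERIV_cmult_Id])
    have dF: "(F has_real_derivative d) (at y)" unfolding F_def by (auto intro!: derivative_eq_intros)
    have "(K has_real_derivative (d\<^sup>2 + \<kappa> ^ 4 * y\<^sup>2 * (F y)\<^sup>2 - N * \<kappa>\<^sup>2 * (F y)\<^sup>2)
       - ((F y)\<^sup>2 * (\<kappa> * (((\<kappa> * y)\<^sup>2 - N - w\<^sup>2) * \<kappa>)) + 2 * F y * d * (\<kappa> * w))) (at y)"
      unfolding K_def w_def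
      by (rule DERIV_diff[OF dP DERIV_mult[OF DERIV_power[OF dF, of 2] DERIV_cmult[OF dw, of \<kappa>]], THEN DERIV_cong])
        (simp add: w_def algebra_simps)
    \<comment> \<open>The Riccati equation cancels the potential and energy terms, so only a perfect
      square remains.\<close>
    also have "(d\<^sup>2 + \<kappa> ^ 4 * y\<^sup>2 * (F y)\<^sup>2 - N * \<kappa>\<^sup>2 * (F y)\<^sup>2)
       - ((F y)\<^sup>2 * (\<kappa> * (((\<kappa> * y)\<^sup>2 - N - w\<^sup>2) * \<kappa>)) + 2 * F y * d * (\<kappa> * w)) = (d - F y * \<kappa> * w)\<^sup>2"
      by (simp add: algebra_simps power2_eq_square power4_eq_xxxx)
    finally show ?thesis by (simp add: w_def)
  qed
  have "((\<lambda>y. (d - F y * \<kappa> * herm_dlog n (\<kappa> * y))\<^sup>2) has_integral (K (x + 1) - K x)) {x..x+1}"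
    using dK contK by (intro fundamental_theorem_of_calculus_interior_strong[OF \<open>finite S\<close>])
      (auto simp: has_real_derivative_iff_has_vector_derivative[symmetric])
  then have "K (x + 1) - K x \<ge> 0" by (rule has_integral_nonneg) auto
  then have le: "G (x + 1) b - G x a \<le> P (x + 1)"
    by (simp add: K_def G_def F_def d_def P_def Q_def)
  have q: "x\<^sup>2 / 6 + x / 6 + 1 / 20 \<ge> 0"
  proof -
    have "x\<^sup>2 / 6 + x / 6 + 1 / 20 = (x + 1 / 2)\<^sup>2 / 6 + 1 / 120"
      by (simp add: power2_eq_square field_simps)
    then show ?thesis by simp
  qed
  \<comment> \<open>Mixed terms are removed by ab = (a^2 + b^2 - (b - a)^2) / 2. This produces the
    correction N \<kappa>^2 / 6 in the first factor and the last term, which is nonnegative after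
    its minus sign and is dropped.\<close>
  have "P (x + 1) = (1 + N * \<kappa>\<^sup>2 / 6) * (b - a)\<^sup>2
     + \<kappa> ^ 4 * (a\<^sup>2 * (x\<^sup>2 / 2 + x / 3 + 1 / 12) + b\<^sup>2 * ((x + 1)\<^sup>2 / 2 - (x + 1) / 3 + 1 / 12))
     - N * \<kappa>\<^sup>2 * (a\<^sup>2 + b\<^sup>2) / 2 - \<kappa> ^ 4 * d\<^sup>2 * (x\<^sup>2 / 6 + x / 6 + 1 / 20)"
    unfolding P_def Q_def c_defs d_def by (simp add: field_simps power2_eq_square)
  moreover have "\<kappa> ^ 4 * d\<^sup>2 * (x\<^sup>2 / 6 + x / 6 + 1 / 20) \<ge> 0"
    using q by (intro mult_nonneg_nonneg) auto
  ultimately show ?thesis using le unfolding N_def by linarith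
qed

section \<open>Piecewise linear interpolation and summation over the cells\<close>

definition interp :: "(int \<Rightarrow> real) \<Rightarrow> real \<Rightarrow> real" where
  "interp f y = f \<lfloor>y\<rfloor> + (y - of_int \<lfloor>y\<rfloor>) * (f (\<lfloor>y\<rfloor> + 1) - f \<lfloor>y\<rfloor>)"

text \<open>The closed cell is covered: at its right endpoint the floor has already jumped, but
  adjacent linear pieces agree there.\<close>

lemma interp_cell:
  assumes "of_int x \<le> y" "y \<le> of_int x + 1"
  shows "interp f y = f x + (y - of_int x) * (f (x + 1) - f x)"
proof (cases "y = of_int x + 1")
  case True
  then have "\<lfloor>y\<rfloor> = x + 1" by simp
  then show ?thesis using True by (simp add: interp_def)
next
  case False
  then have "\<lfloor>y\<rfloor> = x" using assms by (intro floor_unique) auto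
  then show ?thesis by (simp add: interp_def)
qed

text \<open>Outside a finite set of lattice points the weight grows at most linearly, and both f and
  x f(x) are square-summable. This allows the boundary terms to cancel by a shift of
  summation.\<close>

lemma herm_boundary_summable:
  assumes \<kappa>: "\<kappa> > 0" and f: "f \<in> HR_dom"
  shows "(\<lambda>x. (f x)\<^sup>2 * (\<kappa> * herm_dlog n (\<kappa> * real_of_int x))) summable_on UNIV"
proof -
  define G where "G = (\<lambda>x. (f x)\<^sup>2 * (\<kappa> * herm_dlog n (\<kappa> * real_of_int x)))"
  define A where "A = {x::int. real n \<le> \<bar>\<kappa> * real_of_int x\<bar>}"
  have "- A \<subseteq> {- \<lceil>real n / \<kappa>\<rceil>..\<lceil>real n / \<kappa>\<rceil>}"
  proof
    fix x assume "x \<in> - A"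
    then have "\<bar>real_of_int x\<bar> < real n / \<kappa>"
      using \<kappa> by (auto simp: A_def abs_mult field_simps)
    then have "\<bar>real_of_int x\<bar> \<le> real_of_int \<lceil>real n / \<kappa>\<rceil>" by linarith
    then show "x \<in> {- \<lceil>real n / \<kappa>\<rceil>..\<lceil>real n / \<kappa>\<rceil>}" by auto
  qed
  then have "finite (- A)" by (rule finite_subset) simp
  then have fin: "G summable_on (- A)" by simp
  have "(\<lambda>x. norm (G x)) summable_on A"
  proof (rule summable_on_comparison_test)
    have "(\<lambda>x. (2 * real n * \<kappa> + \<kappa>\<^sup>2) * (f x)\<^sup>2 + \<kappa>\<^sup>2 * (real_of_int x * f x)\<^sup>2) summable_on UNIV"
      using HR_dom_lsq[OF f] HR_dom_x[OF f]
      by (intro summable_on_add summable_on_cmult_right) (auto simp: lsq_def)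
    then show "(\<lambda>x. (2 * real n * \<kappa> + \<kappa>\<^sup>2) * (f x)\<^sup>2 + \<kappa>\<^sup>2 * (real_of_int x * f x)\<^sup>2) summable_on A"
      by (rule summable_on_subset_banach) simp
    fix x assume x: "x \<in> A"
    have "\<bar>herm_dlog n (\<kappa> * real_of_int x)\<bar> \<le> 2 * real n + \<bar>\<kappa> * real_of_int x\<bar>"
      using x by (intro herm_dlog_bound) (simp add: A_def)
    also have "\<dots> = 2 * real n + \<kappa> * \<bar>real_of_int x\<bar>" using \<kappa> by (simp add: abs_mult)
    also have "\<bar>real_of_int x\<bar> \<le> 1 + (real_of_int x)\<^sup>2"
      using zero_le_power2[of "\<bar>real_of_int x\<bar> - 1 / 2"] unfolding power2_diff power2_abs by (simp add: power_divide)
    finally have w: "\<bar>herm_dlog n (\<kappa> * real_of_int x)\<bar> \<le> 2 * real n + \<kappa> * (1 + (real_of_int x)\<^sup>2)"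
      using \<kappa> by simp
    have "norm (G x) = (f x)\<^sup>2 * (\<kappa> * \<bar>herm_dlog n (\<kappa> * real_of_int x)\<bar>)"
      using \<kappa> by (simp add: G_def abs_mult)
    also have "\<dots> \<le> (f x)\<^sup>2 * (\<kappa> * (2 * real n + \<kappa> * (1 + (real_of_int x)\<^sup>2)))"
      using w \<kappa> by (intro mult_left_mono) auto
    also have "\<dots> = (2 * real n * \<kappa> + \<kappa>\<^sup>2) * (f x)\<^sup>2 + \<kappa>\<^sup>2 * (real_of_int x * f x)\<^sup>2"
      by (simp add: algebra_simps power2_eq_square)
    finally show "norm (G x) \<le> (2 * real n * \<kappa> + \<kappa>\<^sup>2) * (f x)\<^sup>2 + \<kappa>\<^sup>2 * (real_of_int x * f x)\<^sup>2" .
  qed auto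
  then have "G summable_on A" by (rule abs_summable_summable)
  then have "G summable_on (A \<union> - A)" using fin by (rule summable_on_Un_disjoint) simp
  then show ?thesis by (simp add: G_def)
qed

text \<open>Sum \<open>cell_inequality\<close> over all cells: the boundary terms \<open>G\<close>
  telescope, and each lattice point collects its contributions from the cell on either side.\<close>

lemma form_lower_bound:
  assumes \<kappa>: "\<kappa> > 0" and f: "f \<in> HR_dom"
    and z: "\<And>s. poly (hermite n) s = 0 \<Longrightarrow> interp f (s / \<kappa>) = 0"
  shows "((2 * real n + 1) * \<kappa>\<^sup>2 - \<kappa> ^ 4 / 6) * ip f f \<le> (1 + (2 * real n + 1) * \<kappa>\<^sup>2 / 6) * ip (HR \<kappa> f) f"
proof -
  define N where "N = 2 * real n + 1"
  define c where "c = 1 + N * \<kappa>\<^sup>2 / 6"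
  define G where "G = (\<lambda>x. (f x)\<^sup>2 * (\<kappa> * herm_dlog n (\<kappa> * real_of_int x)))"
  define D where "D = (\<lambda>x. (f (x + 1) - f x)\<^sup>2)"
  define A where "A = (\<lambda>x. (f x)\<^sup>2 * ((real_of_int x)\<^sup>2 / 2 + real_of_int x / 3 + 1 / 12))"
  define B where "B = (\<lambda>x. (f x)\<^sup>2 * ((real_of_int x)\<^sup>2 / 2 - real_of_int x / 3 + 1 / 12))"
  define F where "F = (\<lambda>x. (f x)\<^sup>2)"
  define X where "X = (\<lambda>x. (real_of_int x * f x)\<^sup>2)"
  have fl: "f \<in> lsq" and xl: "(\<lambda>x. real_of_int x * f x) \<in> lsq"
    using f by (auto intro: HR_dom_lsq HR_dom_x)
  have sF: "F summable_on UNIV" and sX: "X summable_on UNIV"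
    using fl xl by (simp_all add: F_def X_def lsq_def)
  have sD: "D summable_on UNIV"
    using lsq_diff[OF lsq_shift[OF fl, of 1] fl] by (simp add: D_def lsq_def)
  have sC: "(\<lambda>x. real_of_int x * f x * f x) summable_on UNIV"
    using xl fl by (rule lsq_mult_summable)
  have comb: "(\<lambda>x. a * X x + b * (real_of_int x * f x * f x) + c * F x) summable_on UNIV" for a b c
    using sX sC sF by (intro summable_on_add summable_on_cmult_right)
  have "A = (\<lambda>x. 1 / 2 * X x + 1 / 3 * (real_of_int x * f x * f x) + 1 / 12 * F x)"
    "B = (\<lambda>x. 1 / 2 * X x + (- 1 / 3) * (real_of_int x * f x * f x) + 1 / 12 * F x)"
    by (simp_all add: A_def B_def X_def F_def fun_eq_iff field_simps power2_eq_square)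
  then have sA: "A summable_on UNIV" and sB: "B summable_on UNIV" by (simp_all only: comb)
  have sG: "G summable_on UNIV" unfolding G_def using \<kappa> f by (rule herm_boundary_summable)
  have sh: "(\<lambda>x. G (x + 1)) summable_on UNIV" "(\<lambda>x. B (x + 1)) summable_on UNIV" "(\<lambda>x. F (x + 1)) summable_on UNIV"
    using sG sB sF by (simp_all add: summable_on_shift_int)
  have hs: "((\<lambda>x. G (x + 1)) has_sum infsum G UNIV) UNIV" "((\<lambda>x. B (x + 1)) has_sum infsum B UNIV) UNIV"
    "((\<lambda>x. F (x + 1)) has_sum infsum F UNIV) UNIV" "(G has_sum infsum G UNIV) UNIV"
    "(F has_sum infsum F UNIV) UNIV" "(A has_sum infsum A UNIV) UNIV" "(D has_sum infsum D UNIV) UNIV"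
    using sG sA sF sD sh by (simp_all add: has_sum_iff infsum_shift_int)
  have cell: "G (x + 1) + N * \<kappa>\<^sup>2 / 2 * (F x + F (x + 1)) \<le> (c * D x + \<kappa> ^ 4 * (A x + B (x + 1))) + G x" for x
  proof -
    have z': "f x + (y - real_of_int x) * (f (x + 1) - f x) = 0"
      if "real_of_int x \<le> y" "y \<le> real_of_int x + 1" "poly (hermite n) (\<kappa> * y) = 0" for y
      using z[OF that(3)] interp_cell[OF that(1,2), of f] \<kappa> by simp
    show ?thesis
      using cell_inequality[OF \<kappa> z']
      by (simp add: G_def A_def B_def F_def D_def c_def N_def algebra_simps add_divide_distrib)
  qed
  have "(\<Sum>\<^sub>\<infinity>x. G (x + 1) + N * \<kappa>\<^sup>2 / 2 * (F x + F (x + 1)))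
      \<le> (\<Sum>\<^sub>\<infinity>x. (c * D x + \<kappa> ^ 4 * (A x + B (x + 1))) + G x)"
    using sG sA sB sD sF sh cell by (intro infsum_mono summable_on_add summable_on_cmult_right)
  moreover have "((\<lambda>x. G (x + 1) + N * \<kappa>\<^sup>2 / 2 * (F x + F (x + 1)))
      has_sum (infsum G UNIV + N * \<kappa>\<^sup>2 / 2 * (infsum F UNIV + infsum F UNIV))) UNIV"
    by (intro has_sum_add has_sum_cmult_right hs)
  then have "(\<Sum>\<^sub>\<infinity>x. G (x + 1) + N * \<kappa>\<^sup>2 / 2 * (F x + F (x + 1)))
      = infsum G UNIV + N * \<kappa>\<^sup>2 * infsum F UNIV"
    by (simp add: infsumI)
  moreover have "((\<lambda>x. (c * D x + \<kappa> ^ 4 * (A x + B (x + 1))) + G x)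
      has_sum (c * infsum D UNIV + \<kappa> ^ 4 * (infsum A UNIV + infsum B UNIV) + infsum G UNIV)) UNIV"
    by (intro has_sum_add has_sum_cmult_right hs)
  then have "(\<Sum>\<^sub>\<infinity>x. (c * D x + \<kappa> ^ 4 * (A x + B (x + 1))) + G x)
      = c * infsum D UNIV + \<kappa> ^ 4 * (infsum A UNIV + infsum B UNIV) + infsum G UNIV"
    by (rule infsumI)
  moreover have "infsum A UNIV + infsum B UNIV = (\<Sum>\<^sub>\<infinity>x. A x + B x)"
    using sA sB by (simp add: infsum_add)
  \<comment> \<open>The terms linear in x cancel between the two adjacent cells; the constants 1/12
    add up to the loss \<kappa>^4 / 6 in the final bound.\<close>
  moreover have "(\<lambda>x. A x + B x) = (\<lambda>x. X x + 1 / 6 * F x)"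
    by (simp add: A_def B_def X_def F_def fun_eq_iff field_simps power2_eq_square)
  moreover have "((\<lambda>x. X x + 1 / 6 * F x) has_sum (infsum X UNIV + 1 / 6 * infsum F UNIV)) UNIV"
    by (intro has_sum_add has_sum_cmult_right hs has_sum_infsum sX)
  then have "(\<Sum>\<^sub>\<infinity>x. X x + 1 / 6 * F x) = infsum X UNIV + 1 / 6 * infsum F UNIV"
    by (rule infsumI)
  ultimately have main: "N * \<kappa>\<^sup>2 * infsum F UNIV
     \<le> c * infsum D UNIV + \<kappa> ^ 4 * (infsum X UNIV + 1 / 6 * infsum F UNIV)" by simp
  have e1: "ip f f = infsum F UNIV" by (simp add: ip_def F_def power2_eq_square)
  have e2: "ip (HR \<kappa> f) f = infsum D UNIV + \<kappa> ^ 4 * infsum X UNIV"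
    unfolding ip_HR[OF f f] D_def X_def by (simp add: power2_eq_square)
  have "infsum X UNIV \<ge> 0" unfolding X_def by (intro infsum_nonneg) auto
  \<comment> \<open>Since c \<ge> 1, the factor carried by the difference part may be put in front
    of the potential part too.\<close>
  then have "\<kappa> ^ 4 * infsum X UNIV \<le> c * (\<kappa> ^ 4 * infsum X UNIV)"
    unfolding c_def N_def by (simp add: mult_right_mono algebra_simps)
  then have "N * \<kappa>\<^sup>2 * infsum F UNIV - \<kappa> ^ 4 / 6 * infsum F UNIV
     \<le> c * (infsum D UNIV + \<kappa> ^ 4 * infsum X UNIV)"
    using main by (simp add: algebra_simps)
  then show ?thesis unfolding e1 e2 N_def[symmetric] c_def[symmetric] by (simp add: algebra_simps)
qed

section \<open>An upper bound for the number of low eigenvalues\<close>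

text \<open>Gaussian elimination: equation \<open>j\<close> is used to eliminate a pivot unknown
  \<open>k\<close>, the reduced system is solved by induction, and the pivot coefficient
  \<open>s\<close> is recovered from equation \<open>j\<close>.\<close>

lemma underdetermined_solution:
  fixes a :: "'i \<Rightarrow> 'j \<Rightarrow> 'a::field"
  assumes "finite J" "finite I" "card J < card I"
  shows "\<exists>c. (\<exists>i\<in>I. c i \<noteq> 0) \<and> (\<forall>j\<in>J. (\<Sum>i\<in>I. c i * a i j) = 0)"
  using assms
proof (induction J arbitrary: I a rule: finite_induct)
  case empty
  then have "I \<noteq> {}" by auto
  then show ?case by (intro exI[where x = "\<lambda>_. 1"]) auto
next
  case (insert j J)
  show ?case
  proof (cases "\<forall>i\<in>I. a i j = 0")
    case True
    have "card J < card I" using insert by simp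
    then obtain c where "\<exists>i\<in>I. c i \<noteq> 0" "\<forall>j\<in>J. (\<Sum>i\<in>I. c i * a i j) = 0"
      using insert.IH[of I a] insert.prems(1) by blast
    then show ?thesis using True by (intro exI[where x = c]) simp
  next
    case False
    then obtain k where k: "k \<in> I" "a k j \<noteq> 0" by blast
    define I' where "I' = I - {k}"
    have I: "I = insert k I'" "k \<notin> I'" "finite I'" using k insert.prems by (auto simp: I'_def)
    then have "card J < card I'" using insert by simp
    then obtain c where c: "\<exists>i\<in>I'. c i \<noteq> 0"
      "\<And>l. l \<in> J \<Longrightarrow> (\<Sum>i\<in>I'. c i * (a i l - a i j / a k j * a k l)) = 0"
      using insert.IH[of I' "\<lambda>i l. a i l - a i j / a k j * a k l"] I(3) by blast
    define s where "s = - (\<Sum>i\<in>I'. c i * a i j) / a k j"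
    define c' where "c' = c(k := s)"
    have sum: "(\<Sum>i\<in>I. c' i * a i l) = s * a k l + (\<Sum>i\<in>I'. c i * a i l)" for l
    proof -
      have "(\<Sum>i\<in>I'. c' i * a i l) = (\<Sum>i\<in>I'. c i * a i l)"
        using I(2) by (intro sum.cong) (auto simp: c'_def)
      then show ?thesis using I(2,3) unfolding I(1) by (simp add: c'_def)
    qed
    have "(\<Sum>i\<in>I. c' i * a i l) = 0" if "l \<in> insert j J" for l
    proof (cases "l = j")
      case True
      then show ?thesis unfolding sum using k(2) by (simp add: s_def)
    next
      case False
      then have "0 = (\<Sum>i\<in>I'. c i * (a i l - a i j / a k j * a k l))" using that c(2) by simp
      also have "\<dots> = (\<Sum>i\<in>I'. c i * a i l) - (\<Sum>i\<in>I'. c i * a i j) / a k j * a k l"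
        by (simp add: right_diff_distrib sum_subtractf sum_divide_distrib sum_distrib_right mult.assoc)
      finally show ?thesis unfolding sum s_def by (simp add: algebra_simps)
    qed
    moreover have "\<exists>i\<in>I. c' i \<noteq> 0" using c(1) I by (auto simp: c'_def)
    ultimately show ?thesis by blast
  qed
qed

text \<open>With more than n eigenvalues, a nonzero combination of eigenfunctions has an interpolant
  vanishing at the rescaled zeros of \<open>hermite n\<close>. Orthogonality bounds its form by L
  times its squared norm, against \<open>form_lower_bound\<close>. The bound concerns finite subsets
  because \<open>card\<close> of an infinite set is 0; finiteness of the whole set follows from
  it.\<close>

lemma card_eigenvalues_le:
  assumes \<kappa>: "\<kappa> > 0"
    and L: "L * (1 + (2 * real n + 1) * \<kappa>\<^sup>2 / 6) < (2 * real n + 1) * \<kappa>\<^sup>2 - \<kappa> ^ 4 / 6"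
    and M: "finite M" "M \<subseteq> {\<mu>. is_eigenvalue \<kappa> \<mu> \<and> \<mu> \<le> L}"
  shows "card M \<le> n"
proof (rule ccontr)
  assume "\<not> card M \<le> n"
  define Z where "Z = {s. poly (hermite n) s = 0}"
  have "card Z \<le> degree (hermite n)"
    unfolding Z_def by (rule card_poly_roots_bound) (rule hermite_nonzero)
  then have cZ: "card Z < card M" using degree_hermite[of n] \<open>\<not> card M \<le> n\<close> by simp
  have finZ: "finite Z" unfolding Z_def by (intro poly_roots_finite hermite_nonzero)
  have "\<exists>f. HR_ev \<kappa> \<mu> f" if "\<mu> \<in> M" for \<mu>
    using M(2) that by (auto simp: is_eigenvalue_iff_HR_ev)
  then obtain e where e: "\<And>\<mu>. \<mu> \<in> M \<Longrightarrow> HR_ev \<kappa> \<mu> (e \<mu>)" by metis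
  obtain c \<mu>0 where c: "\<mu>0 \<in> M" "c \<mu>0 \<noteq> 0"
    "\<And>s. s \<in> Z \<Longrightarrow> (\<Sum>\<mu>\<in>M. c \<mu> * interp (e \<mu>) (s / \<kappa>)) = 0"
    using underdetermined_solution[OF finZ M(1) cZ, of "\<lambda>\<mu> s. interp (e \<mu>) (s / \<kappa>)"] by blast
  have ed: "e \<mu> \<in> HR_dom" if "\<mu> \<in> M" for \<mu> using HR_ev_dom[OF \<kappa> e[OF that]] .
  then have el: "e \<mu> \<in> lsq" if "\<mu> \<in> M" for \<mu> using that by (simp add: HR_dom_lsq)
  have eH: "HR \<kappa> (e \<mu>) = (\<lambda>x. \<mu> * e \<mu> x)" if "\<mu> \<in> M" for \<mu>
    using e[OF that] by (simp add: HR_ev_def fun_eq_iff)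
  have epos: "ip (e \<mu>) (e \<mu>) > 0" if "\<mu> \<in> M" for \<mu>
    using e[OF that] by (auto simp: HR_ev_def intro: ip_self_pos)
  define f where "f = (\<lambda>x. \<Sum>\<mu>\<in>M. c \<mu> * e \<mu> x)"
  have fd: "f \<in> HR_dom" unfolding f_def using ed by (intro HR_dom_sum HR_dom_cmult)
  \<comment> \<open>Orthogonality leaves one term. It is used with b = c(\<mu>) for the norm and b =
    c(\<mu>) \<mu> for the form.\<close>
  have cross: "ip (\<lambda>x. b * e \<mu> x) f = b * c \<mu> * ip (e \<mu>) (e \<mu>)" if "\<mu> \<in> M" for b \<mu>
  proof -
    have "ip (\<lambda>x. b * e \<mu> x) f = (\<Sum>\<nu>\<in>M. b * (c \<nu> * ip (e \<mu>) (e \<nu>)))"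
      unfolding f_def using el that by (subst ip_sum_right) (auto intro: lsq_cmult simp: ip_cmult_left ip_cmult_right)
    also have "\<dots> = (\<Sum>\<nu>\<in>M. if \<nu> = \<mu> then b * c \<mu> * ip (e \<mu>) (e \<mu>) else 0)"
    proof (rule sum.cong)
      fix \<nu> assume "\<nu> \<in> M"
      then show "b * (c \<nu> * ip (e \<mu>) (e \<nu>)) = (if \<nu> = \<mu> then b * c \<mu> * ip (e \<mu>) (e \<mu>) else 0)"
        using HR_ev_orthogonal[OF \<kappa> e[OF that] e[of \<nu>]] by auto
    qed simp
    also have "\<dots> = b * c \<mu> * ip (e \<mu>) (e \<mu>)" using that M(1) by simp
    finally show ?thesis .
  qed
  have ff: "ip f f = (\<Sum>\<mu>\<in>M. (c \<mu>)\<^sup>2 * ip (e \<mu>) (e \<mu>))"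
  proof -
    have "ip f f = (\<Sum>\<mu>\<in>M. ip (\<lambda>x. c \<mu> * e \<mu> x) f)"
      unfolding f_def using el by (intro ip_sum_left lsq_cmult lsq_sum) auto
    also have "\<dots> = (\<Sum>\<mu>\<in>M. c \<mu> * c \<mu> * ip (e \<mu>) (e \<mu>))"
      by (intro sum.cong refl cross)
    finally show ?thesis by (simp add: power2_eq_square)
  qed
  have Hff: "ip (HR \<kappa> f) f = (\<Sum>\<mu>\<in>M. \<mu> * ((c \<mu>)\<^sup>2 * ip (e \<mu>) (e \<mu>)))"
  proof -
    have "HR \<kappa> f = (\<lambda>x. \<Sum>\<mu>\<in>M. (c \<mu> * \<mu>) * e \<mu> x)"
      unfolding f_def HR_sum HR_cmult by (intro ext sum.cong) (simp_all add: eH mult.assoc)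
    then have "ip (HR \<kappa> f) f = ip (\<lambda>x. \<Sum>\<mu>\<in>M. (c \<mu> * \<mu>) * e \<mu> x) f" by (rule arg_cong)
    also have "\<dots> = (\<Sum>\<mu>\<in>M. ip (\<lambda>x. (c \<mu> * \<mu>) * e \<mu> x) f)"
      using el HR_dom_lsq[OF fd] by (intro ip_sum_left lsq_cmult) auto
    also have "\<dots> = (\<Sum>\<mu>\<in>M. c \<mu> * \<mu> * c \<mu> * ip (e \<mu>) (e \<mu>))"
      by (intro sum.cong refl cross)
    finally show ?thesis by (simp add: power2_eq_square mult_ac)
  qed
  have "ip (HR \<kappa> f) f \<le> (\<Sum>\<mu>\<in>M. L * ((c \<mu>)\<^sup>2 * ip (e \<mu>) (e \<mu>)))"
    unfolding Hff using M(2) by (intro sum_mono mult_right_mono) (auto simp: ip_self_nonneg)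
  then have up: "ip (HR \<kappa> f) f \<le> L * ip f f" by (simp add: ff sum_distrib_left)
  have "interp f (s / \<kappa>) = (\<Sum>\<mu>\<in>M. c \<mu> * interp (e \<mu>) (s / \<kappa>))" for s
    unfolding interp_def f_def sum_subtractf[symmetric] sum_distrib_left sum.distrib[symmetric]
    by (intro sum.cong) (simp_all add: algebra_simps)
  then have "interp f (s / \<kappa>) = 0" if "poly (hermite n) s = 0" for s
    using c(3)[of s] that by (simp add: Z_def)
  then have "((2 * real n + 1) * \<kappa>\<^sup>2 - \<kappa> ^ 4 / 6) * ip f f \<le> (1 + (2 * real n + 1) * \<kappa>\<^sup>2 / 6) * ip (HR \<kappa> f) f"
    by (rule form_lower_bound[OF \<kappa> fd])
  also have "\<dots> \<le> (1 + (2 * real n + 1) * \<kappa>\<^sup>2 / 6) * (L * ip f f)"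
    using up by (intro mult_left_mono) auto
  also have "\<dots> = L * (1 + (2 * real n + 1) * \<kappa>\<^sup>2 / 6) * ip f f" by simp
  finally have "((2 * real n + 1) * \<kappa>\<^sup>2 - \<kappa> ^ 4 / 6) * ip f f \<le> L * (1 + (2 * real n + 1) * \<kappa>\<^sup>2 / 6) * ip f f" .
  moreover have "ip f f > 0"
  proof -
    have "0 < (c \<mu>0)\<^sup>2 * ip (e \<mu>0) (e \<mu>0)" using c epos by simp
    also have "\<dots> \<le> ip f f" unfolding ff using c M(1)
      by (intro member_le_sum) (auto simp: ip_self_nonneg)
    finally show ?thesis .
  qed
  ultimately show False using L by simp
qed

section \<open>An eigenvalue near every approximate eigenvalue\<close>

text \<open>The product of the intervals [-1, 1] is compact by Tychonoff, and sequentially compact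
  because the countable product is metrizable.\<close>

lemma pointwise_convergent_subsequence:
  fixes u :: "nat \<Rightarrow> int \<Rightarrow> real"
  assumes "\<And>j x. \<bar>u j x\<bar> \<le> 1"
  obtains r v where "strict_mono (r :: nat \<Rightarrow> nat)" "\<And>x. (\<lambda>j. u (r j) x) \<longlonglongrightarrow> v x"
proof -
  define K where "K = PiE (UNIV :: int set) (\<lambda>_. {-1..1::real})"
  have "compactin (product_topology (\<lambda>_. euclidean) UNIV) K"
    unfolding K_def compactin_PiE by simp
  then have "compact K" by (simp add: euclidean_product_topology)
  moreover have "u j \<in> K" for j
    using assms by (auto simp: K_def PiE_def Pi_def abs_le_iff minus_le_iff)
  ultimately obtain v r where r: "strict_mono (r :: nat \<Rightarrow> nat)" "(u \<circ> r) \<longlonglongrightarrow> v"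
    unfolding compact_eq_seq_compact_metric seq_compact_def by metis
  have "(\<lambda>j. u (r j) x) \<longlonglongrightarrow> v x" for x
  proof -
    have "continuous_on UNIV (\<lambda>f :: int \<Rightarrow> real. f x)" by simp
    then have "isCont (\<lambda>f :: int \<Rightarrow> real. f x) v" by (simp add: continuous_on_eq_continuous_within del: continuous_on_product_coordinates)
    from isCont_tendsto_compose[OF this r(2)] show ?thesis by (simp add: o_def)
  qed
  then show thesis using r(1) that by blast
qed

lemma lsq_bounded_sums:
  assumes "\<And>F. finite F \<Longrightarrow> (\<Sum>x\<in>F. (v x)\<^sup>2) \<le> c"
  shows "v \<in> lsq" "ip v v \<le> c"
proof -
  show v: "v \<in> lsq"
    unfolding lsq_def using assms
    by (auto intro!: nonneg_bdd_above_summable_on bdd_aboveI[where M = c])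
  have "(\<lambda>x. v x * v x) summable_on UNIV" using v v by (rule lsq_mult_summable)
  then show "ip v v \<le> c"
    unfolding ip_def by (rule infsum_le_finite_sums) (use assms in \<open>simp add: power2_eq_square\<close>)
qed

lemma sum_le_ip:
  assumes "v \<in> lsq" "finite F"
  shows "(\<Sum>x\<in>F. (v x)\<^sup>2) \<le> ip v v"
proof -
  have "(\<Sum>x\<in>F. v x * v x) \<le> ip v v"
    unfolding ip_def using assms by (intro finite_sum_le_infsum lsq_mult_summable) auto
  then show ?thesis by (simp add: power2_eq_square)
qed

text \<open>Fatou's lemma for sums: finite partial sums pass to the limit, and each is dominated by
  the bounds \<open>b j\<close>.\<close>

lemma lsq_fatou:
  assumes "\<And>x. (\<lambda>j. u j x) \<longlonglongrightarrow> v x" "\<And>j. u j \<in> lsq" "\<And>j. ip (u j) (u j) \<le> b j" "b \<longlonglongrightarrow> c"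
  shows "v \<in> lsq" "ip v v \<le> c"
proof -
  have *: "(\<Sum>x\<in>F. (v x)\<^sup>2) \<le> c" if "finite F" for F
  proof (rule LIMSEQ_le)
    show "(\<lambda>j. \<Sum>x\<in>F. (u j x)\<^sup>2) \<longlonglongrightarrow> (\<Sum>x\<in>F. (v x)\<^sup>2)"
      using assms(1) by (intro tendsto_intros)
    show "\<exists>N. \<forall>j\<ge>N. (\<Sum>x\<in>F. (u j x)\<^sup>2) \<le> b j"
      using sum_le_ip[OF assms(2) that] assms(3) by (meson order_trans)
  qed (rule assms(4))
  show "v \<in> lsq" "ip v v \<le> c" using lsq_bounded_sums[OF *] by blast+
qed

section \<open>The shifted operator and the minimization of its residual\<close>

definition HRs :: "real \<Rightarrow> real \<Rightarrow> (int \<Rightarrow> real) \<Rightarrow> (int \<Rightarrow> real)" where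
  "HRs \<kappa> l f = (\<lambda>x. HR \<kappa> f x - l * f x)"

lemma HRs_lsq: "f \<in> HR_dom \<Longrightarrow> HRs \<kappa> l f \<in> lsq"
  unfolding HRs_def by (intro lsq_diff lsq_cmult HR_lsq HR_dom_lsq)

lemma HRs_add_cmult: "HRs \<kappa> l (\<lambda>x. f x + c * g x) = (\<lambda>x. HRs \<kappa> l f x + c * HRs \<kappa> l g x)"
  by (simp add: HRs_def HR_add HR_cmult fun_eq_iff algebra_simps)

lemma HRs_cmult: "HRs \<kappa> l (\<lambda>x. c * f x) = (\<lambda>x. c * HRs \<kappa> l f x)"
  by (simp add: HRs_def HR_cmult fun_eq_iff algebra_simps)

text \<open>Unit vectors serve as directions of variation, so that stationarity becomes a pointwise
  equation.\<close>

definition delta :: "int \<Rightarrow> int \<Rightarrow> real" where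
  "delta y = (\<lambda>x. if x = y then 1 else 0)"

lemma finite_support_lsq:
  assumes "finite {x. f x \<noteq> 0}"
  shows "f \<in> lsq"
  unfolding lsq_def mem_Collect_eq by (rule finite_nonzero_values_imp_summable_on) (use assms in simp)

lemma delta_dom: "delta y \<in> HR_dom"
  unfolding HR_dom_def delta_def by (auto intro!: finite_support_lsq)

lemma ip_finite_support:
  assumes "finite F" "\<And>x. x \<notin> F \<Longrightarrow> f x = 0"
  shows "ip g f = (\<Sum>x\<in>F. g x * f x)"
proof -
  have "ip g f = infsum (\<lambda>x. g x * f x) F"
    unfolding ip_def by (rule infsum_cong_neutral) (use assms in auto)
  then show ?thesis using assms(1) by simp
qed

lemma ip_delta: "ip g (delta y) = g y"
  by (subst ip_finite_support[of "{y}"]) (auto simp: delta_def)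

text \<open>Symmetry with an arbitrary \<open>g\<close>, possible because
  \<open>HRs \<kappa> l (delta y)\<close> has finite support. It is later applied to
  \<open>g = HRs \<kappa> l v\<close>, whose membership in \<open>HR_dom\<close> is not
  established.\<close>

lemma ip_HRs_delta: "ip g (HRs \<kappa> l (delta y)) = HRs \<kappa> l g y"
  by (subst ip_finite_support[of "{y - 1, y, y + 1}"])
    (auto simp: delta_def HRs_def HR_def algebra_simps)

lemma quadratic_nonneg_linear_zero:
  fixes a b :: real
  assumes "\<And>t. 2 * t * a + t\<^sup>2 * b \<ge> 0"
  shows "a = 0"
proof (rule ccontr)
  assume a: "a \<noteq> 0"
  define d where "d = \<bar>b\<bar> + 1"
  have d: "d > 0" "b < d" by (auto simp: d_def)
  \<comment> \<open>A small step against the sign of \<open>a\<close>: as d > b and d > 0, the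
    linear term outweighs the quadratic one.\<close>
  have "0 \<le> 2 * (- a / d) * a + (- a / d)\<^sup>2 * b" by (rule assms)
  also have "\<dots> = (a / d)\<^sup>2 * (b - 2 * d)"
    using d by (simp add: field_simps power2_eq_square)
  also have "\<dots> < 0" using a d by (intro mult_pos_neg) auto
  finally show False by simp
qed

lemma ip_add_cmult_self:
  assumes "f \<in> lsq" "g \<in> lsq"
  shows "ip (\<lambda>x. f x + t * g x) (\<lambda>x. f x + t * g x) = ip f f + 2 * t * ip f g + t\<^sup>2 * ip g g"
proof -
  have tg: "(\<lambda>x. t * g x) \<in> lsq" using assms by (intro lsq_cmult)
  show ?thesis
    using assms tg ip_commute[of g f]
    by (simp add: ip_add_left ip_add_right lsq_add ip_cmult_left ip_cmult_right power2_eq_square algebra_simps)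
qed

text \<open>Coercivity: the potential term equals the residual plus (l - 2) f(x) and the two
  neighbours of f, and a sum of four terms has square at most four times the sum of squares.\<close>

lemma position_bound:
  assumes f: "f \<in> HR_dom" and one: "ip f f = 1"
  shows "ip (\<lambda>x. \<kappa> ^ 4 * (real_of_int x)\<^sup>2 * f x) (\<lambda>x. \<kappa> ^ 4 * (real_of_int x)\<^sup>2 * f x)
    \<le> 4 * (ip (HRs \<kappa> l f) (HRs \<kappa> l f) + (l - 2)\<^sup>2 + 2)"
proof (rule lsq_bounded_sums)
  fix F :: "int set" assume F: "finite F"
  have fl: "f \<in> lsq" using f by (rule HR_dom_lsq)
  have sq4: "(a + b + c + d)\<^sup>2 \<le> 4 * (a\<^sup>2 + b\<^sup>2 + c\<^sup>2 + d\<^sup>2)" for a b c d :: real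
  proof -
    have "0 \<le> (a - b)\<^sup>2 + (a - c)\<^sup>2 + (a - d)\<^sup>2 + (b - c)\<^sup>2 + (b - d)\<^sup>2 + (c - d)\<^sup>2" by simp
    then show ?thesis by (simp add: power2_eq_square algebra_simps)
  qed
  have "(\<Sum>x\<in>F. (\<kappa> ^ 4 * (real_of_int x)\<^sup>2 * f x)\<^sup>2)
    \<le> (\<Sum>x\<in>F. 4 * ((HRs \<kappa> l f x)\<^sup>2 + ((l - 2) * f x)\<^sup>2 + (f (x + 1))\<^sup>2 + (f (x + (- 1)))\<^sup>2))"
  proof (rule sum_mono)
    fix x
    have e: "\<kappa> ^ 4 * (real_of_int x)\<^sup>2 * f x = HRs \<kappa> l f x + (l - 2) * f x + f (x + 1) + f (x + (- 1))"
      by (simp add: HRs_def HR_def algebra_simps)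
    show "(\<kappa> ^ 4 * (real_of_int x)\<^sup>2 * f x)\<^sup>2
      \<le> 4 * ((HRs \<kappa> l f x)\<^sup>2 + ((l - 2) * f x)\<^sup>2 + (f (x + 1))\<^sup>2 + (f (x + (- 1)))\<^sup>2)"
      unfolding e by (rule sq4)
  qed
  also have "\<dots> = 4 * ((\<Sum>x\<in>F. (HRs \<kappa> l f x)\<^sup>2) + (l - 2)\<^sup>2 * (\<Sum>x\<in>F. (f x)\<^sup>2)
      + (\<Sum>x\<in>F. (f (x + 1))\<^sup>2) + (\<Sum>x\<in>F. (f (x + (- 1)))\<^sup>2))"
    by (simp add: sum.distrib sum_distrib_left power_mult_distrib distrib_left)
  also have "\<dots> \<le> 4 * (ip (HRs \<kappa> l f) (HRs \<kappa> l f) + (l - 2)\<^sup>2 * 1 + 1 + 1)"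
  proof -
    have "ip (\<lambda>x. f (x + a)) (\<lambda>x. f (x + a)) = 1" for a
      using infsum_shift_int[of "\<lambda>x. f x * f x" a] one by (simp add: ip_def)
    then have sh: "(\<Sum>x\<in>F. (f (x + a))\<^sup>2) \<le> 1" for a
      using sum_le_ip[OF lsq_shift[OF fl, of a] F] by simp
    show ?thesis
      using sum_le_ip[OF HRs_lsq[OF f] F, of \<kappa> l] sh[of 0] sh[of 1] sh[of "-1"]
      by (intro mult_left_mono add_mono) auto
  qed
  finally show "(\<Sum>x\<in>F. (\<kappa> ^ 4 * (real_of_int x)\<^sup>2 * f x)\<^sup>2)
    \<le> 4 * (ip (HRs \<kappa> l f) (HRs \<kappa> l f) + (l - 2)\<^sup>2 + 2)" by simp
qed

text \<open>Outside the window |x| \<ge> N, so f^2 is at most (x^2 f)^2 / N^4; the weaker factor 1/N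
  suffices for a uniform tail estimate.\<close>

lemma tail_bound:
  assumes f: "f \<in> lsq" and N: "N \<ge> 1" and X: "(\<lambda>x. (real_of_int x)\<^sup>2 * f x) \<in> lsq"
    and B: "ip (\<lambda>x. (real_of_int x)\<^sup>2 * f x) (\<lambda>x. (real_of_int x)\<^sup>2 * f x) \<le> B"
  shows "ip f f \<le> (\<Sum>x\<in>{- int N..int N}. (f x)\<^sup>2) + B / real N"
proof (rule lsq_bounded_sums)
  fix G :: "int set" assume G: "finite G"
  let ?W = "{- int N..int N}"
  have "(\<Sum>x\<in>G. (f x)\<^sup>2) = (\<Sum>x\<in>G \<inter> ?W. (f x)\<^sup>2) + (\<Sum>x\<in>G - ?W. (f x)\<^sup>2)"
    using G by (simp add: sum.Int_Diff)
  moreover have "(\<Sum>x\<in>G \<inter> ?W. (f x)\<^sup>2) \<le> (\<Sum>x\<in>?W. (f x)\<^sup>2)"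
    by (intro sum_mono2) auto
  moreover have "(\<Sum>x\<in>G - ?W. (f x)\<^sup>2) \<le> (\<Sum>x\<in>G - ?W. ((real_of_int x)\<^sup>2 * f x)\<^sup>2 / real N)"
  proof (rule sum_mono)
    fix x assume "x \<in> G - ?W"
    then have x: "real N \<le> \<bar>real_of_int x\<bar>" by auto
    have "real N \<le> real N ^ 4" using N by (simp add: self_le_power)
    also have "\<dots> \<le> \<bar>real_of_int x\<bar> ^ 4" using x by (intro power_mono) auto
    also have "\<dots> = ((real_of_int x)\<^sup>2)\<^sup>2" by (simp flip: power_mult)
    finally have "real N * (f x)\<^sup>2 \<le> ((real_of_int x)\<^sup>2)\<^sup>2 * (f x)\<^sup>2" by (intro mult_right_mono) auto
    then show "(f x)\<^sup>2 \<le> ((real_of_int x)\<^sup>2 * f x)\<^sup>2 / real N"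
      using N by (simp add: power_mult_distrib field_simps)
  qed
  moreover have "(\<Sum>x\<in>G - ?W. ((real_of_int x)\<^sup>2 * f x)\<^sup>2 / real N) \<le> B / real N"
    unfolding sum_divide_distrib[symmetric]
    using order_trans[OF sum_le_ip[OF X, of "G - ?W"] B] G by (intro divide_right_mono) auto
  ultimately show "(\<Sum>x\<in>G. (f x)\<^sup>2) \<le> (\<Sum>x\<in>?W. (f x)\<^sup>2) + B / real N" by linarith
qed

text \<open>The direct method: a pointwise limit of a minimizing sequence inherits all upper bounds
  by \<open>lsq_fatou\<close>, and the confining potential prevents loss of norm.\<close>

lemma residual_minimizer:
  assumes \<kappa>: "\<kappa> > 0"
    and u: "\<And>j. u j \<in> HR_dom" "\<And>j. ip (u j) (u j) = 1"
    and b: "\<And>j. ip (HRs \<kappa> l (u j)) (HRs \<kappa> l (u j)) \<le> b j" "b \<longlonglongrightarrow> m"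
  obtains v where "v \<in> HR_dom" "ip v v = 1" "ip (HRs \<kappa> l v) (HRs \<kappa> l v) \<le> m"
proof -
  have ul: "u j \<in> lsq" for j using u(1) by (rule HR_dom_lsq)
  have "\<bar>u j x\<bar> \<le> 1" for j x
    using sum_le_ip[OF ul, of "{x}" j] u(2)[of j] by (simp add: abs_square_le_1)
  then obtain r v where r: "strict_mono (r :: nat \<Rightarrow> nat)" and v: "\<And>x. (\<lambda>j. u (r j) x) \<longlonglongrightarrow> v x"
    using pointwise_convergent_subsequence[of u] by blast
  have br: "(\<lambda>j. b (r j)) \<longlonglongrightarrow> m"
    using LIMSEQ_subseq_LIMSEQ[OF b(2) r] by (simp add: o_def)
  obtain M where M: "\<And>j. b j \<le> M"
    using convergent_imp_Bseq[OF convergentI[OF b(2)]] by (auto simp: Bseq_def abs_le_iff)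
  define B where "B = 4 * (M + (l - 2)\<^sup>2 + 2) / (\<kappa> ^ 4)\<^sup>2"
  let ?X = "\<lambda>f x. (real_of_int x)\<^sup>2 * f x"
  have uX: "?X (u j) \<in> lsq" for j using u(1)[of j] by (simp add: HR_dom_def)
  have uB: "ip (?X (u j)) (?X (u j)) \<le> B" for j
  proof -
    have "(\<kappa> ^ 4)\<^sup>2 * ip (?X (u j)) (?X (u j)) = ip (\<lambda>x. \<kappa> ^ 4 * ?X (u j) x) (\<lambda>x. \<kappa> ^ 4 * ?X (u j) x)"
      by (simp only: ip_cmult_left ip_cmult_right power2_eq_square mult.assoc)
    also have "\<dots> \<le> 4 * (ip (HRs \<kappa> l (u j)) (HRs \<kappa> l (u j)) + (l - 2)\<^sup>2 + 2)"
      using position_bound[OF u(1) u(2), of \<kappa> j l] by (simp only: mult.assoc)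
    also have "\<dots> \<le> 4 * (M + (l - 2)\<^sup>2 + 2)" using b(1)[of j] M[of j] by simp
    finally show ?thesis using \<kappa> by (simp add: B_def pos_le_divide_eq mult.commute)
  qed
  have vl: "v \<in> lsq" and v1: "ip v v \<le> 1"
    using lsq_fatou[of "\<lambda>j. u (r j)" v "\<lambda>_. 1" 1] v ul u(2) by auto
  have "(\<lambda>j. ?X (u (r j)) x) \<longlonglongrightarrow> ?X v x" for x
    using v by (intro tendsto_intros)
  then have "?X v \<in> lsq"
    using lsq_fatou(1)[of "\<lambda>j. ?X (u (r j))" "?X v" "\<lambda>_. B" B] uX uB by auto
  then have vd: "v \<in> HR_dom" using vl by (simp add: HR_dom_def)
  have "(\<lambda>j. HRs \<kappa> l (u (r j)) x) \<longlonglongrightarrow> HRs \<kappa> l v x" for x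
    unfolding HRs_def HR_def using v by (intro tendsto_intros)
  then have "ip (HRs \<kappa> l v) (HRs \<kappa> l v) \<le> m"
    using lsq_fatou(2)[of "\<lambda>j. HRs \<kappa> l (u (r j))" "HRs \<kappa> l v" "\<lambda>j. b (r j)" m] HRs_lsq[OF u(1)] b(1) br by auto
  \<comment> \<open>No mass escapes to infinity: each window of radius N keeps at least 1 - B/N of
    it, uniformly along the sequence, and N is then sent to infinity.\<close>
  moreover have "1 \<le> ip v v"
  proof -
    have low: "1 - B / real N \<le> ip v v" if N: "N \<ge> 1" for N
    proof -
      have "1 - B / real N \<le> (\<Sum>x\<in>{- int N..int N}. (v x)\<^sup>2)"
      proof (rule LIMSEQ_le_const)
        show "(\<lambda>j. \<Sum>x\<in>{- int N..int N}. (u (r j) x)\<^sup>2) \<longlonglongrightarrow> (\<Sum>x\<in>{- int N..int N}. (v x)\<^sup>2)"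
          using v by (intro tendsto_intros)
        show "\<exists>k. \<forall>j\<ge>k. 1 - B / real N \<le> (\<Sum>x\<in>{- int N..int N}. (u (r j) x)\<^sup>2)"
          using tail_bound[OF ul N uX uB] u(2) by (auto simp: algebra_simps)
      qed
      also have "\<dots> \<le> ip v v" using vl by (rule sum_le_ip) simp
      finally show ?thesis .
    qed
    have "(\<lambda>N. 1 - B / real N) \<longlonglongrightarrow> 1 - 0"
      by (intro tendsto_intros lim_const_over_n)
    then show ?thesis
      using LIMSEQ_le_const2[of "\<lambda>N. 1 - B / real N" 1 "ip v v"] low by auto
  qed
  ultimately show thesis using that vd v1 by (metis order_antisym)
qed

text \<open>The trial vector gives m \<le> \<rho>^2 for the minimum m, and (H - l)^2 - m = (H - l -
  s)(H - l + s) with s = \<surd>m makes l + s or l - s an eigenvalue.\<close>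

lemma eigenvalue_near:
  assumes \<kappa>: "\<kappa> > 0" and \<rho>: "\<rho> \<ge> 0" and f: "f \<in> HR_dom" "ip f f > 0"
    and res: "ip (HRs \<kappa> l f) (HRs \<kappa> l f) \<le> \<rho>\<^sup>2 * ip f f"
  shows "\<exists>\<mu>. is_eigenvalue \<kappa> \<mu> \<and> \<bar>\<mu> - l\<bar> \<le> \<rho>"
proof -
  let ?J = "\<lambda>f. ip (HRs \<kappa> l f) (HRs \<kappa> l f)"
  define S where "S = {f \<in> HR_dom. ip f f = 1}"
  define m where "m = Inf (?J ` S)"
  have bdd: "bdd_below (?J ` S)" by (intro bdd_belowI[where m = 0]) (auto simp: ip_self_nonneg)
  have norm: "(\<lambda>x. (1 / sqrt (ip g g)) * g x) \<in> S"
    "?J (\<lambda>x. (1 / sqrt (ip g g)) * g x) = ?J g / ip g g"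
    if "g \<in> HR_dom" "ip g g > 0" for g
  proof -
    have s: "sqrt (ip g g) * sqrt (ip g g) = ip g g" using that by simp
    show "(\<lambda>x. (1 / sqrt (ip g g)) * g x) \<in> S"
      unfolding S_def mem_Collect_eq ip_cmult_left ip_cmult_right
    proof (rule conjI[OF HR_dom_cmult[OF that(1)]])
      show "1 / sqrt (ip g g) * (1 / sqrt (ip g g) * ip g g) = 1"
        using s that(2) by (simp add: field_simps)
    qed
    show "?J (\<lambda>x. (1 / sqrt (ip g g)) * g x) = ?J g / ip g g"
      unfolding HRs_cmult ip_cmult_left ip_cmult_right
      using s that(2) by (simp add: field_simps)
  qed
  have Sne: "S \<noteq> {}" using norm(1)[OF f] by blast
  have m_le: "m * ip g g \<le> ?J g" if "g \<in> HR_dom" for g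
  proof (cases "ip g g > 0")
    case True
    have "m \<le> ?J (\<lambda>x. (1 / sqrt (ip g g)) * g x)"
      unfolding m_def by (rule cInf_lower[OF imageI[OF norm(1)[OF that True]] bdd])
    then show ?thesis using norm(2)[OF that True] True by (simp add: pos_le_divide_eq)
  next
    case False
    then show ?thesis using ip_self_nonneg[of g] ip_self_nonneg[of "HRs \<kappa> l g"] by simp
  qed
  have m0: "m \<ge> 0" unfolding m_def by (rule cInf_greatest) (use Sne in \<open>auto simp: ip_self_nonneg\<close>)
  have m\<rho>: "m \<le> \<rho>\<^sup>2"
    using order_trans[OF m_le[OF f(1)] res] f(2) by simp
  have "\<exists>g\<in>S. ?J g \<le> m + 1 / real (Suc j)" for j
  proof -
    have "Inf (?J ` S) < m + 1 / real (Suc j)" by (simp add: m_def)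
    then show ?thesis using cInf_lessD[of "?J ` S"] Sne by force
  qed
  then obtain u where u: "\<And>j. u j \<in> S" "\<And>j. ?J (u j) \<le> m + 1 / real (Suc j)" by metis
  have "(\<lambda>j. m + 1 / real (Suc j)) \<longlonglongrightarrow> m"
    using tendsto_add[OF tendsto_const LIMSEQ_inverse_real_of_nat, of m] by (simp add: inverse_eq_divide)
  then obtain v where v: "v \<in> HR_dom" "ip v v = 1" "?J v \<le> m"
    using residual_minimizer[OF \<kappa>, of u l "\<lambda>j. m + 1 / real (Suc j)" m] u unfolding S_def by blast
  have Jv: "?J v = m" using m_le[OF v(1)] v by simp
  have vl: "v \<in> lsq" "HRs \<kappa> l v \<in> lsq" using v(1) by (auto intro: HR_dom_lsq HRs_lsq)
  \<comment> \<open>The Euler-Lagrange equation at y: J - m times the squared norm is nonnegative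
    and vanishes at \<open>v\<close>, so its first variation along \<open>delta y\<close> is
    zero.\<close>
  have EL: "HRs \<kappa> l (HRs \<kappa> l v) y = m * v y" for y
  proof -
    have "2 * t * (HRs \<kappa> l (HRs \<kappa> l v) y - m * v y)
      + t\<^sup>2 * (?J (delta y) - m * ip (delta y) (delta y)) \<ge> 0" for t
    proof -
      have dl: "delta y \<in> lsq" "HRs \<kappa> l (delta y) \<in> lsq"
        using delta_dom by (auto intro: HR_dom_lsq HRs_lsq)
      have "m * ip (\<lambda>x. v x + t * delta y x) (\<lambda>x. v x + t * delta y x) \<le> ?J (\<lambda>x. v x + t * delta y x)"
        using v(1) by (intro m_le HR_dom_add HR_dom_cmult delta_dom)
      then show ?thesis
        unfolding HRs_add_cmult ip_add_cmult_self[OF vl(1) dl(1)] ip_add_cmult_self[OF vl(2) dl(2)]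
          ip_HRs_delta ip_delta[of v] Jv v(2) by (simp add: algebra_simps)
    qed
    then have "HRs \<kappa> l (HRs \<kappa> l v) y - m * v y = 0" by (rule quadratic_nonneg_linear_zero)
    then show ?thesis by simp
  qed
  define s where "s = sqrt m"
  have s: "s * s = m" "s \<ge> 0" "s \<le> \<rho>"
    using m0 real_le_lsqrt[OF \<rho> m\<rho>] by (auto simp: s_def)
  \<comment> \<open>One factor of (H - l)^2 - m applied to \<open>v\<close>. If nonzero, it is an
    eigenfunction for l + s; if zero, \<open>v\<close> itself is one for l - s.\<close>
  define g where "g = (\<lambda>x. HRs \<kappa> l v x + s * v x)"
  have "\<exists>\<mu>. is_eigenvalue \<kappa> \<mu> \<and> (\<mu> = l + s \<or> \<mu> = l - s)"
  proof (cases "\<exists>x. g x \<noteq> 0")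
    case True
    have "g \<in> lsq" unfolding g_def using vl by (intro lsq_add lsq_cmult)
    moreover have "HRs \<kappa> l g x = s * g x" for x
      unfolding g_def HRs_add_cmult EL s(1)[symmetric] by (simp add: algebra_simps)
    then have "HR \<kappa> g x = (l + s) * g x" for x
      by (simp add: HRs_def algebra_simps)
    ultimately have "HR_ev \<kappa> (l + s) g" using True by (simp add: HR_ev_def)
    then show ?thesis unfolding is_eigenvalue_iff_HR_ev by blast
  next
    case False
    have "HR \<kappa> v x = (l - s) * v x" for x
    proof -
      have "g x = 0" using False by blast
      then show ?thesis by (simp add: g_def HRs_def algebra_simps)
    qed
    moreover have "\<exists>x. v x \<noteq> 0"
    proof (rule ccontr)
      assume "\<not> ?thesis"
      then have "ip v v = 0" by (simp add: ip_def)
      then show False using v(2) by simp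
    qed
    ultimately have "HR_ev \<kappa> (l - s) v" using vl by (simp add: HR_ev_def)
    then show ?thesis unfolding is_eigenvalue_iff_HR_ev by blast
  qed
  then show ?thesis using s by auto
qed

section \<open>Sampled Hermite functions\<close>

text \<open>Polynomials times a Gaussian form a class closed under differentiation, with
  \<open>gderiv\<close> acting on the polynomial factor.\<close>

definition gpoly :: "real poly \<Rightarrow> real \<Rightarrow> real" where
  "gpoly p s = poly p s * exp (- (s\<^sup>2 / 2))"

definition gderiv :: "real poly \<Rightarrow> real poly" where
  "gderiv p = pderiv p - [:0, 1:] * p"

lemma gpoly_has_derivative: "(gpoly p has_real_derivative gpoly (gderiv p) s) (at s)"
  unfolding gpoly_def[abs_def] gderiv_def
  by (auto intro!: derivative_eq_intros simp: algebra_simps)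

text \<open>Exponential bounds survive multiplication by s, since |s| \<le> exp |s|, and are still
  beaten by the Gaussian.\<close>

lemma poly_exp_bound: "\<exists>C d. C \<ge> 0 \<and> (\<forall>s::real. \<bar>poly p s\<bar> \<le> C * exp (d * \<bar>s\<bar>))"
proof (induction p)
  case 0
  show ?case by (intro exI[where x = 0]) auto
next
  case (pCons a p)
  then obtain C d where C: "C \<ge> 0" "\<And>s. \<bar>poly p s\<bar> \<le> C * exp (d * \<bar>s\<bar>)" by blast
  have "\<bar>poly (pCons a p) s\<bar> \<le> (\<bar>a\<bar> + C) * exp ((\<bar>d\<bar> + 1) * \<bar>s\<bar>)" for s
  proof -
    have "\<bar>poly (pCons a p) s\<bar> \<le> \<bar>a\<bar> + \<bar>s\<bar> * \<bar>poly p s\<bar>"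
      by (simp add: abs_mult[symmetric] abs_triangle_ineq)
    also have "\<dots> \<le> \<bar>a\<bar> * exp ((\<bar>d\<bar> + 1) * \<bar>s\<bar>) + exp \<bar>s\<bar> * (C * exp (\<bar>d\<bar> * \<bar>s\<bar>))"
    proof (intro add_mono mult_mono)
      show "\<bar>a\<bar> \<le> \<bar>a\<bar> * exp ((\<bar>d\<bar> + 1) * \<bar>s\<bar>)" by (simp add: mult_le_cancel_left1)
      show "\<bar>s\<bar> \<le> exp \<bar>s\<bar>" using exp_ge_add_one_self[of "\<bar>s\<bar>"] by linarith
      have "d * \<bar>s\<bar> \<le> \<bar>d\<bar> * \<bar>s\<bar>" by (intro mult_right_mono) auto
      then show "\<bar>poly p s\<bar> \<le> C * exp (\<bar>d\<bar> * \<bar>s\<bar>)"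
        by (intro order_trans[OF C(2)] mult_left_mono C(1)) simp
    qed auto
    also have "\<dots> = (\<bar>a\<bar> + C) * exp ((\<bar>d\<bar> + 1) * \<bar>s\<bar>)"
      by (simp add: distrib_right exp_add[symmetric] mult.left_commute)
    finally show ?thesis .
  qed
  moreover have "\<bar>a\<bar> + C \<ge> 0" using C(1) by simp
  ultimately show ?case by blast
qed

lemma gpoly_bounded: "\<exists>C \<ge> 0. \<forall>s. \<bar>gpoly p s\<bar> \<le> C"
proof -
  obtain C d where C: "C \<ge> 0" "\<And>s. \<bar>poly p s\<bar> \<le> C * exp (d * \<bar>s\<bar>)"
    using poly_exp_bound by blast
  have "\<bar>gpoly p s\<bar> \<le> C * exp (d\<^sup>2 / 2)" for s
  proof -
    have "\<bar>gpoly p s\<bar> \<le> C * exp (d * \<bar>s\<bar>) * exp (- (s\<^sup>2 / 2))"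
      unfolding gpoly_def abs_mult by (simp add: C(2))
    also have "\<dots> = C * exp (d * \<bar>s\<bar> - s\<^sup>2 / 2)" by (simp add: mult.assoc exp_add[symmetric])
    also have "\<dots> \<le> C * exp (d\<^sup>2 / 2)"
    proof (intro mult_left_mono C(1))
      have "0 \<le> (d - \<bar>s\<bar>)\<^sup>2" by simp
      then show "exp (d * \<bar>s\<bar> - s\<^sup>2 / 2) \<le> exp (d\<^sup>2 / 2)" by (simp add: power2_diff field_simps)
    qed
    finally show ?thesis .
  qed
  then show ?thesis using C(1) by (intro exI[where x = "C * exp (d\<^sup>2 / 2)"]) simp
qed

text \<open>Boundedness is applied to the polynomial (1 + s^2) p. This rate of decay is chosen
  because its lattice sums compare with arctan.\<close>

lemma gpoly_decay: "\<exists>C \<ge> 0. \<forall>s. \<bar>gpoly p s\<bar> \<le> C / (1 + s\<^sup>2)"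
proof -
  obtain C where C: "C \<ge> 0" "\<And>s. \<bar>gpoly ([:1, 0, 1:] * p) s\<bar> \<le> C"
    using gpoly_bounded by blast
  have "\<bar>gpoly p s\<bar> \<le> C / (1 + s\<^sup>2)" for s
  proof -
    have p: "1 + s\<^sup>2 > 0" by (simp add: add_pos_nonneg)
    have "gpoly ([:1, 0, 1:] * p) s = (1 + s\<^sup>2) * gpoly p s"
      by (simp add: gpoly_def algebra_simps power2_eq_square)
    then have "(1 + s\<^sup>2) * \<bar>gpoly p s\<bar> \<le> C" using C(2)[of s] p by (simp add: abs_mult)
    then show ?thesis using p by (simp add: pos_le_divide_eq mult.commute)
  qed
  then show ?thesis using C(1) by blast
qed

section \<open>Lattice sums and the norm of sampled functions\<close>

text \<open>Integral comparison through the mean value theorem: the derivative of arctan decreases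
  on the nonnegative axis.\<close>

lemma lattice_sum_step:
  fixes \<kappa> :: real
  assumes "\<kappa> > 0"
  shows "\<kappa> / (1 + (\<kappa> * real (Suc N))\<^sup>2) \<le> arctan (\<kappa> * real (Suc N)) - arctan (\<kappa> * real N)"
proof -
  have lt: "\<kappa> * real N < \<kappa> * real (Suc N)" using assms by simp
  obtain z where z: "z > \<kappa> * real N" "z < \<kappa> * real (Suc N)"
    "arctan (\<kappa> * real (Suc N)) - arctan (\<kappa> * real N) = (\<kappa> * real (Suc N) - \<kappa> * real N) * inverse (1 + z\<^sup>2)"
    using MVT2[OF lt, of arctan "\<lambda>x. inverse (1 + x\<^sup>2)"] DERIV_arctan by blast
  have "z \<ge> 0" using z(1) assms by (smt (verit) mult_nonneg_nonneg of_nat_0_le_iff)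
  then have "z\<^sup>2 \<le> (\<kappa> * real (Suc N))\<^sup>2" using z(2) by (intro power_mono) auto
  then have "\<kappa> / (1 + (\<kappa> * real (Suc N))\<^sup>2) \<le> \<kappa> / (1 + z\<^sup>2)"
    using assms by (intro divide_left_mono mult_pos_pos) (auto simp: add_pos_nonneg)
  also have "\<dots> = arctan (\<kappa> * real (Suc N)) - arctan (\<kappa> * real N)"
    unfolding z(3) by (simp add: algebra_simps divide_inverse)
  finally show ?thesis .
qed

text \<open>A Riemann sum for the integral of 1/(1 + s^2), which is \<pi>; the extra \<kappa> is the
  term at x = 0.\<close>

lemma lattice_sum_bound:
  fixes \<kappa> :: real
  assumes \<kappa>: "\<kappa> > 0" and F: "finite F"
  shows "(\<Sum>x\<in>F. \<kappa> / (1 + (\<kappa> * real_of_int x)\<^sup>2)) \<le> \<kappa> + pi"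
proof -
  let ?g = "\<lambda>x. \<kappa> / (1 + (\<kappa> * real_of_int x)\<^sup>2)"
  have sym: "(\<Sum>x\<in>{- int N..int N}. ?g x) \<le> \<kappa> + 2 * arctan (\<kappa> * real N)" for N
  proof (induction N)
    case (Suc N)
    have "{- int (Suc N)..int (Suc N)} = insert (- int (Suc N)) (insert (int (Suc N)) {- int N..int N})"
      by auto
    then have "(\<Sum>x\<in>{- int (Suc N)..int (Suc N)}. ?g x)
        = ?g (- int (Suc N)) + (?g (int (Suc N)) + (\<Sum>x\<in>{- int N..int N}. ?g x))"
      by simp
    moreover have "?g (- int (Suc N)) = \<kappa> / (1 + (\<kappa> * real (Suc N))\<^sup>2)"
      "?g (int (Suc N)) = \<kappa> / (1 + (\<kappa> * real (Suc N))\<^sup>2)"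
      by (simp_all only: of_int_minus of_int_of_nat_eq mult_minus_right power2_minus)
    ultimately show ?case using Suc lattice_sum_step[OF \<kappa>, of N] by linarith
  qed simp
  define N where "N = nat (Max (insert 0 (abs ` F)))"
  have "F \<subseteq> {- int N..int N}"
  proof
    fix x assume "x \<in> F"
    then have "\<bar>x\<bar> \<le> Max (insert 0 (abs ` F))" using F by (intro Max_ge) auto
    then show "x \<in> {- int N..int N}" by (auto simp: N_def)
  qed
  then have "(\<Sum>x\<in>F. ?g x) \<le> (\<Sum>x\<in>{- int N..int N}. ?g x)"
    using \<kappa> by (intro sum_mono2) (auto simp: add_nonneg_nonneg)
  also have "\<dots> \<le> \<kappa> + 2 * arctan (\<kappa> * real N)" by (rule sym)
  also have "\<dots> \<le> \<kappa> + pi" using arctan_ubound[of "\<kappa> * real N"] by simp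
  finally show ?thesis .
qed

lemma decaying_lattice_function:
  assumes \<kappa>: "\<kappa> > 0" and g: "\<And>x. \<bar>g x\<bar> \<le> C / (1 + (\<kappa> * real_of_int x)\<^sup>2)"
  shows "g \<in> lsq" "ip g g \<le> C\<^sup>2 * (\<kappa> + pi) / \<kappa>"
proof -
  have *: "(\<Sum>x\<in>F. (g x)\<^sup>2) \<le> C\<^sup>2 * (\<kappa> + pi) / \<kappa>" if "finite F" for F
  proof -
    have "(g x)\<^sup>2 \<le> C\<^sup>2 / \<kappa> * (\<kappa> / (1 + (\<kappa> * real_of_int x)\<^sup>2))" for x
    proof -
      define t where "t = 1 + (\<kappa> * real_of_int x)\<^sup>2"
      have t: "t \<ge> 1" by (simp add: t_def)
      have "(g x)\<^sup>2 \<le> (C / t)\<^sup>2" using power_mono[OF g[of x], of 2] by (simp add: t_def)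
      also have "\<dots> = C\<^sup>2 / (t * t)" by (simp add: power_divide power2_eq_square[of t])
      also have "\<dots> \<le> C\<^sup>2 / t"
        using t by (intro divide_left_mono mult_pos_pos) (auto simp: mult_le_cancel_left1)
      finally show ?thesis using \<kappa> by (simp add: t_def)
    qed
    then have "(\<Sum>x\<in>F. (g x)\<^sup>2) \<le> C\<^sup>2 / \<kappa> * (\<Sum>x\<in>F. \<kappa> / (1 + (\<kappa> * real_of_int x)\<^sup>2))"
      unfolding sum_distrib_left by (intro sum_mono)
    also have "\<dots> \<le> C\<^sup>2 / \<kappa> * (\<kappa> + pi)"
      using \<kappa> that by (intro mult_left_mono lattice_sum_bound) auto
    finally show ?thesis by simp
  qed
  show "g \<in> lsq" "ip g g \<le> C\<^sup>2 * (\<kappa> + pi) / \<kappa>" using lsq_bounded_sums[OF *] by blast+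
qed

lemma gpoly_lattice_lsq:
  assumes "\<kappa> > 0"
  shows "(\<lambda>x. gpoly p (\<kappa> * real_of_int x)) \<in> lsq"
proof -
  obtain C where "\<And>s. \<bar>gpoly p s\<bar> \<le> C / (1 + s\<^sup>2)" using gpoly_decay by blast
  then show ?thesis by (intro decaying_lattice_function(1)[OF assms])
qed

lemma gpoly_lattice_dom:
  assumes \<kappa>: "\<kappa> > 0"
  shows "(\<lambda>x. gpoly p (\<kappa> * real_of_int x)) \<in> HR_dom"
proof -
  have "(\<lambda>x. (1 / \<kappa>\<^sup>2) * gpoly ([:0, 0, 1:] * p) (\<kappa> * real_of_int x)) \<in> lsq"
    using \<kappa> by (intro lsq_cmult gpoly_lattice_lsq)
  moreover have "(1 / \<kappa>\<^sup>2) * gpoly ([:0, 0, 1:] * p) (\<kappa> * real_of_int x)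
    = (real_of_int x)\<^sup>2 * gpoly p (\<kappa> * real_of_int x)" for x
    using \<kappa> by (simp add: gpoly_def power2_eq_square)
  ultimately show ?thesis using gpoly_lattice_lsq[OF \<kappa>] by (simp add: HR_dom_def)
qed

lemma gpoly_taylor:
  assumes "h \<noteq> 0"
  shows "\<exists>t. \<bar>t - s\<bar> \<le> \<bar>h\<bar> \<and>
    gpoly p (s + h) = gpoly p s + gpoly (gderiv p) s * h + gpoly (gderiv (gderiv p)) s / 2 * h\<^sup>2
      + gpoly (gderiv (gderiv (gderiv p))) t / 6 * h ^ 3"
proof -
  define diff where "diff = (\<lambda>m. gpoly ((gderiv ^^ m) p))"
  have "\<exists>t. (if s + h < s then s + h < t \<and> t < s else s < t \<and> t < s + h) \<and>
    gpoly p (s + h) = (\<Sum>m<3. diff m s / fact m * (s + h - s) ^ m) + diff 3 t / fact 3 * (s + h - s) ^ 3"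
  proof (rule Taylor[where a = "s - \<bar>h\<bar>" and b = "s + \<bar>h\<bar>"])
    show "\<forall>m t. m < 3 \<and> s - \<bar>h\<bar> \<le> t \<and> t \<le> s + \<bar>h\<bar> \<longrightarrow> DERIV (diff m) t :> diff (Suc m) t"
      by (simp add: diff_def gpoly_has_derivative)
  qed (use assms in \<open>auto simp: diff_def\<close>)
  then obtain t where t: "if s + h < s then s + h < t \<and> t < s else s < t \<and> t < s + h"
    "gpoly p (s + h) = (\<Sum>m<3. diff m s / fact m * (s + h - s) ^ m) + diff 3 t / fact 3 * (s + h - s) ^ 3"
    by blast
  have "\<bar>t - s\<bar> \<le> \<bar>h\<bar>" using t(1) by (auto split: if_splits)
  moreover have "gpoly p (s + h) = gpoly p s + gpoly (gderiv p) s * h + gpoly (gderiv (gderiv p)) s / 2 * h\<^sup>2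
      + gpoly (gderiv (gderiv (gderiv p))) t / 6 * h ^ 3"
    unfolding t(2) by (simp add: diff_def eval_nat_numeral fact_numeral)
  ultimately show ?thesis by blast
qed

text \<open>First-order terms cancel in the symmetric difference, leaving third-order Taylor
  remainders. They are evaluated within \<kappa> \<le> 1 of s, where the decay is comparable to that
  at s.\<close>

lemma gpoly_second_difference:
  "\<exists>C \<ge> 0. \<forall>\<kappa> s. 0 < \<kappa> \<and> \<kappa> \<le> 1 \<longrightarrow>
    \<bar>gpoly p (s + \<kappa>) + gpoly p (s - \<kappa>) - 2 * gpoly p s - \<kappa>\<^sup>2 * gpoly (gderiv (gderiv p)) s\<bar>
      \<le> C * \<kappa> ^ 3 / (1 + s\<^sup>2)"
proof -
  let ?q = "gderiv (gderiv (gderiv p))"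
  obtain C where C: "C \<ge> 0" "\<And>t. \<bar>gpoly ?q t\<bar> \<le> C / (1 + t\<^sup>2)" using gpoly_decay by blast
  have "\<bar>gpoly p (s + \<kappa>) + gpoly p (s - \<kappa>) - 2 * gpoly p s - \<kappa>\<^sup>2 * gpoly (gderiv (gderiv p)) s\<bar>
      \<le> C * \<kappa> ^ 3 / (1 + s\<^sup>2)" if \<kappa>: "0 < \<kappa>" "\<kappa> \<le> 1" for \<kappa> s
  proof -
    have far: "\<bar>gpoly ?q t\<bar> \<le> 3 * C / (1 + s\<^sup>2)" if "\<bar>t - s\<bar> \<le> \<kappa>" for t
    proof -
      have "(t - s)\<^sup>2 \<le> 1" using that \<kappa> by (simp add: abs_square_le_1)
      \<comment> \<open>A sum-of-squares certificate for 1 + s^2 \<le> 3 (1 + t^2).\<close>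
      then have "0 \<le> 2 * (1 - (t - s)\<^sup>2) + (2 * t - s)\<^sup>2 + t\<^sup>2"
        by (intro add_nonneg_nonneg) auto
      also have "\<dots> = 3 * (1 + t\<^sup>2) - (1 + s\<^sup>2)"
        by (simp add: power2_eq_square algebra_simps)
      finally have "1 + s\<^sup>2 \<le> 3 * (1 + t\<^sup>2)" by (rule diff_ge_0_iff_ge[THEN iffD1])
      then have "C * (1 + s\<^sup>2) \<le> C * (3 * (1 + t\<^sup>2))" using C(1) by (intro mult_left_mono) auto
      moreover have "1 + s\<^sup>2 > 0" "1 + t\<^sup>2 > 0" by (simp_all add: add_pos_nonneg)
      ultimately have "C / (1 + t\<^sup>2) \<le> 3 * C / (1 + s\<^sup>2)"
        by (simp add: frac_le_eq divide_le_0_iff) (simp add: algebra_simps)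
      then show ?thesis using C(2)[of t] by linarith
    qed
    obtain t1 where t1: "\<bar>t1 - s\<bar> \<le> \<kappa>" "gpoly p (s + \<kappa>) = gpoly p s + gpoly (gderiv p) s * \<kappa>
        + gpoly (gderiv (gderiv p)) s / 2 * \<kappa>\<^sup>2 + gpoly ?q t1 / 6 * \<kappa> ^ 3"
      using gpoly_taylor[of \<kappa> s p] \<kappa> by auto
    obtain t2 where t2: "\<bar>t2 - s\<bar> \<le> \<kappa>" "gpoly p (s - \<kappa>) = gpoly p s - gpoly (gderiv p) s * \<kappa>
        + gpoly (gderiv (gderiv p)) s / 2 * \<kappa>\<^sup>2 - gpoly ?q t2 / 6 * \<kappa> ^ 3"
      using gpoly_taylor[of "- \<kappa>" s p] \<kappa> by (auto simp: power3_eq_cube)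
    have "gpoly p (s + \<kappa>) + gpoly p (s - \<kappa>) - 2 * gpoly p s - \<kappa>\<^sup>2 * gpoly (gderiv (gderiv p)) s
      = \<kappa> ^ 3 / 6 * (gpoly ?q t1 - gpoly ?q t2)"
      unfolding t1(2) t2(2) by (simp add: algebra_simps)
    also have "\<bar>\<dots>\<bar> = \<kappa> ^ 3 / 6 * \<bar>gpoly ?q t1 - gpoly ?q t2\<bar>" using \<kappa> by (simp add: abs_mult)
    also have "\<dots> \<le> \<kappa> ^ 3 / 6 * (3 * C / (1 + s\<^sup>2) + 3 * C / (1 + s\<^sup>2))"
      using far[OF t1(1)] far[OF t2(1)] \<kappa> by (intro mult_left_mono) (linarith, simp)
    also have "\<dots> = C * \<kappa> ^ 3 / (1 + s\<^sup>2)" by simp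
    finally show ?thesis .
  qed
  then show ?thesis using C(1) by blast
qed

text \<open>By continuity the squared function stays above some e > 0 on an interval of length 2d,
  which contains at least 2d/\<kappa> - 1 \<ge> d/\<kappa> points of the lattice of step \<kappa>
  \<le> d.\<close>

lemma gpoly_lattice_lower:
  assumes "p \<noteq> 0"
  shows "\<exists>c>0. \<exists>d>0. \<forall>\<kappa>. 0 < \<kappa> \<and> \<kappa> \<le> d \<longrightarrow>
    c / \<kappa> \<le> ip (\<lambda>x. gpoly p (\<kappa> * real_of_int x)) (\<lambda>x. gpoly p (\<kappa> * real_of_int x))"
proof -
  have "\<exists>s. poly p s \<noteq> 0" using assms poly_all_0_iff_0 by blast
  then obtain s where "poly p s \<noteq> 0" by blast
  then have s: "gpoly p s \<noteq> 0" by (simp add: gpoly_def)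
  define e where "e = (gpoly p s)\<^sup>2 / 2"
  have e: "e > 0" "e < (gpoly p s)\<^sup>2" using s by (auto simp: e_def)
  have "isCont (\<lambda>t. (gpoly p t)\<^sup>2) s"
    using DERIV_isCont[OF gpoly_has_derivative] by (intro continuous_intros)
  then have "\<forall>\<^sub>F t in at s. e < (gpoly p t)\<^sup>2"
    using e(2) by (auto simp: isCont_def intro: order_tendstoD)
  then obtain d0 where d0: "d0 > 0" "\<And>t. t \<noteq> s \<Longrightarrow> dist t s < d0 \<Longrightarrow> e < (gpoly p t)\<^sup>2"
    by (auto simp: eventually_at)
  define d where "d = d0 / 2"
  have d: "d > 0" "\<And>t. \<bar>t - s\<bar> \<le> d \<Longrightarrow> e \<le> (gpoly p t)\<^sup>2"
  proof -
    show "d > 0" using d0 by (simp add: d_def)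
    show "e \<le> (gpoly p t)\<^sup>2" if "\<bar>t - s\<bar> \<le> d" for t
      using d0 that e(2) by (cases "t = s") (auto simp: d_def dist_real_def intro!: less_imp_le)
  qed
  have "e * d / \<kappa> \<le> ip (\<lambda>x. gpoly p (\<kappa> * real_of_int x)) (\<lambda>x. gpoly p (\<kappa> * real_of_int x))"
    if \<kappa>: "0 < \<kappa>" "\<kappa> \<le> d" for \<kappa>
  proof -
    define F where "F = {\<lceil>(s - d) / \<kappa>\<rceil>..\<lfloor>(s + d) / \<kappa>\<rfloor>}"
    have "d / \<kappa> \<le> 2 * d / \<kappa> - 1" using \<kappa> by (simp add: field_simps)
    also have "2 * d / \<kappa> = (s + d) / \<kappa> - (s - d) / \<kappa>" by (simp add: diff_divide_distrib add_divide_distrib)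
    also have "(s + d) / \<kappa> - (s - d) / \<kappa> - 1 \<le> real_of_int (\<lfloor>(s + d) / \<kappa>\<rfloor> - \<lceil>(s - d) / \<kappa>\<rceil> + 1)"
      by (simp add: of_int_add of_int_diff) linarith
    also have "\<dots> \<le> real (card F)" unfolding F_def by simp
    finally have card: "d / \<kappa> \<le> real (card F)" .
    have "e * (d / \<kappa>) \<le> e * real (card F)" using card e(1) by (intro mult_left_mono) auto
    also have "\<dots> = (\<Sum>x\<in>F. e)" by simp
    also have "\<dots> \<le> (\<Sum>x\<in>F. (gpoly p (\<kappa> * real_of_int x))\<^sup>2)"
    proof (intro sum_mono d(2))
      fix x assume "x \<in> F"
      then have "(s - d) / \<kappa> \<le> real_of_int x" "real_of_int x \<le> (s + d) / \<kappa>"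
        by (auto simp: F_def ceiling_le_iff le_floor_iff)
      then show "\<bar>\<kappa> * real_of_int x - s\<bar> \<le> d"
        using \<kappa> by (simp add: field_simps abs_le_iff)
    qed
    also have "\<dots> \<le> ip (\<lambda>x. gpoly p (\<kappa> * real_of_int x)) (\<lambda>x. gpoly p (\<kappa> * real_of_int x))"
      using \<kappa> by (intro sum_le_ip gpoly_lattice_lsq) (simp_all add: F_def)
    finally show ?thesis by simp
  qed
  then show ?thesis using d(1) e(1) by (intro exI[where x = "e * d"] conjI exI[where x = d]) auto
qed

text \<open>The Hermite function is an eigenfunction of the harmonic oscillator -d^2/ds^2 + s^2 with
  eigenvalue 2n + 1.\<close>

lemma hermite_oscillator:
  "gpoly (gderiv (gderiv (hermite n))) s = (s\<^sup>2 - (2 * real n + 1)) * gpoly (hermite n) s"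
proof -
  have "poly (gderiv (gderiv (hermite n))) s = poly (pderiv (pderiv (hermite n))) s
     - 2 * s * poly (pderiv (hermite n)) s + (s\<^sup>2 - 1) * poly (hermite n) s"
    by (simp add: gderiv_def pderiv_diff pderiv_mult pderiv_pCons algebra_simps power2_eq_square)
  also have "\<dots> = (s\<^sup>2 - (2 * real n + 1)) * poly (hermite n) s"
    using hermite_ode[of n s] by (simp add: algebra_simps)
  finally show ?thesis by (simp add: gpoly_def)
qed

text \<open>For the sampled Hermite function the squared residual is O(\<kappa>^6 / \<kappa>) and
  the squared norm at least c/\<kappa>, so \<open>eigenvalue_near\<close> applies with \<rho> of
  order \<kappa>^3.\<close>

lemma eigenvalue_near_oscillator_level:
  "\<exists>C \<ge> 0. \<exists>d>0. \<forall>\<kappa>. 0 < \<kappa> \<and> \<kappa> \<le> d \<longrightarrow>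
    (\<exists>\<mu>. is_eigenvalue \<kappa> \<mu> \<and> \<bar>\<mu> - (2 * real n + 1) * \<kappa>\<^sup>2\<bar> \<le> C * \<kappa> ^ 3)"
proof -
  define p where "p = hermite n"
  obtain C where C: "C \<ge> 0" "\<And>\<kappa> s. 0 < \<kappa> \<Longrightarrow> \<kappa> \<le> 1 \<Longrightarrow>
    \<bar>gpoly p (s + \<kappa>) + gpoly p (s - \<kappa>) - 2 * gpoly p s - \<kappa>\<^sup>2 * gpoly (gderiv (gderiv p)) s\<bar>
      \<le> C * \<kappa> ^ 3 / (1 + s\<^sup>2)"
    using gpoly_second_difference by blast
  obtain c d where c: "c > 0" "d > 0" "\<And>\<kappa>. 0 < \<kappa> \<Longrightarrow> \<kappa> \<le> d \<Longrightarrow>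
    c / \<kappa> \<le> ip (\<lambda>x. gpoly p (\<kappa> * real_of_int x)) (\<lambda>x. gpoly p (\<kappa> * real_of_int x))"
    using gpoly_lattice_lower[OF hermite_nonzero, of n] unfolding p_def by blast
  define K where "K = C * sqrt ((1 + pi) / c)"
  have K: "K \<ge> 0" "K\<^sup>2 * c = C\<^sup>2 * (1 + pi)"
    using C(1) c(1) by (auto simp: K_def power_mult_distrib add_nonneg_nonneg)
  have "\<exists>\<mu>. is_eigenvalue \<kappa> \<mu> \<and> \<bar>\<mu> - (2 * real n + 1) * \<kappa>\<^sup>2\<bar> \<le> K * \<kappa> ^ 3"
    if \<kappa>: "0 < \<kappa>" "\<kappa> \<le> min d 1" for \<kappa>
  proof (rule eigenvalue_near)
    define f where "f = (\<lambda>x. gpoly p (\<kappa> * real_of_int x))"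
    define l where "l = (2 * real n + 1) * \<kappa>\<^sup>2"
    show "f \<in> HR_dom" unfolding f_def using \<kappa>(1) by (rule gpoly_lattice_dom)
    have low: "c / \<kappa> \<le> ip f f" unfolding f_def using c(3) \<kappa> by simp
    then show "ip f f > 0" using c(1) \<kappa>(1) by (meson divide_pos_pos less_le_trans)
    have "\<bar>HRs \<kappa> l f x\<bar> \<le> (C * \<kappa> ^ 3) / (1 + (\<kappa> * real_of_int x)\<^sup>2)" for x
    proof -
      define s where "s = \<kappa> * real_of_int x"
      have sh: "\<kappa> * real_of_int (x + 1) = s + \<kappa>" "\<kappa> * real_of_int (x - 1) = s - \<kappa>"
        by (simp_all add: s_def algebra_simps)
      \<comment> \<open>By the oscillator equation, \<kappa>^2 times the second derivative equals
        (\<kappa>^4 x^2 - l) f(x), so the residual is exactly the error of the second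
        difference.\<close>
      have "HRs \<kappa> l f x = - (gpoly p (s + \<kappa>) + gpoly p (s - \<kappa>) - 2 * gpoly p s - \<kappa>\<^sup>2 * gpoly (gderiv (gderiv p)) s)"
        unfolding HRs_def HR_def f_def sh p_def hermite_oscillator l_def s_def[symmetric]
        by (simp add: s_def algebra_simps power2_eq_square power4_eq_xxxx)
      then show ?thesis using C(2)[of \<kappa> s] \<kappa> unfolding s_def by simp
    qed
    then have "ip (HRs \<kappa> l f) (HRs \<kappa> l f) \<le> (C * \<kappa> ^ 3)\<^sup>2 * (\<kappa> + pi) / \<kappa>"
      by (rule decaying_lattice_function(2)[OF \<kappa>(1)])
    also have "\<dots> \<le> (C * \<kappa> ^ 3)\<^sup>2 * (1 + pi) / \<kappa>"
      using \<kappa> by (intro divide_right_mono mult_left_mono) auto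
    also have "\<dots> = (K * \<kappa> ^ 3)\<^sup>2 * (c / \<kappa>)"
      using K(2) by (simp add: power_mult_distrib mult.assoc mult.left_commute[of _ c] mult.commute) 
    also have "\<dots> \<le> (K * \<kappa> ^ 3)\<^sup>2 * ip f f" using low by (intro mult_left_mono) auto
    finally show "ip (HRs \<kappa> ((2 * real n + 1) * \<kappa>\<^sup>2) f) (HRs \<kappa> ((2 * real n + 1) * \<kappa>\<^sup>2) f) \<le> (K * \<kappa> ^ 3)\<^sup>2 * ip f f"
      by (simp add: l_def)
  qed (use \<kappa> K in auto)
  then show ?thesis using K(1) c(2) by (intro exI[where x = K] conjI exI[where x = "min d 1"]) auto
qed

section \<open>Simplicity of the eigenvalues and the limit\<close>

lemma eigenspace_recurrence:
  assumes "f \<in> eigenspace \<kappa> lam"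
  shows "f (x + 1) = complex_of_real (2 + \<kappa> ^ 4 * (real_of_int x)\<^sup>2 - lam) * f x - f (x - 1)"
proof -
  have "H \<kappa> f x = complex_of_real lam * f x"
    using assms by (simp add: eigenspace_def)
  then show ?thesis by (simp add: H_def algebra_simps)
qed

lemma recurrence_zero:
  fixes h :: "int \<Rightarrow> complex"
  assumes rec: "\<And>x. h (x + 1) = q x * h x - h (x - 1)" and h: "h 0 = 0" "h 1 = 0"
  shows "h x = 0"
proof -
  have "h x = 0 \<and> h (x + 1) = 0"
  proof (induction x rule: int_induct[where k = 0])
    case (step1 i)
    then show ?case using rec[of "i + 1"] by simp
  next
    case (step2 i)
    have "h (i - 1) = q i * h i - h (i + 1)" using rec[of i] by (simp add: algebra_simps)
    with step2 show ?case by simp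
  qed (use h in simp)
  then show ?thesis ..
qed

text \<open>The recurrence makes the Wronskian constant in x, while square-summability makes it
  summable; a summable constant on the integers is 0.\<close>

lemma wronskian_zero:
  assumes f: "f \<in> eigenspace \<kappa> lam" and g: "g \<in> eigenspace \<kappa> lam"
  shows "f 1 * g 0 = f 0 * g 1"
proof -
  define W where "W = (\<lambda>x. f (x + 1) * g x - f x * g (x + 1))"
  have step: "W (x + 1) = W x" for x
    unfolding W_def eigenspace_recurrence[OF f, of "x + 1"] eigenspace_recurrence[OF g, of "x + 1"]
    by (simp add: algebra_simps)
  have const: "W x = W 0" for x
  proof (induction x rule: int_induct[where k = 0])
    case (step1 i)
    then show ?case using step[of i] by simp
  next
    case (step2 i)
    then show ?case using step[of "i - 1"] by simp
  qed simp
  have nf: "(\<lambda>x. norm (f x)) \<in> lsq" "(\<lambda>x. norm (g x)) \<in> lsq"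
    using f g by (auto simp: eigenspace_def ell2Z_def lsq_def)
  define h where "h = (\<lambda>x. norm (f (x + 1)) * norm (g x) + norm (f x) * norm (g (x + 1)))"
  have hs: "h summable_on UNIV"
    unfolding h_def using nf lsq_shift[OF nf(1), of 1] lsq_shift[OF nf(2), of 1]
    by (intro summable_on_add lsq_mult_summable)
  have "norm (W 0) \<le> h x" for x
    unfolding const[of x, symmetric] unfolding W_def h_def
    by (rule order_trans[OF norm_triangle_ineq4]) (simp add: norm_mult)
  then have "(\<Sum>x\<in>{0..<int N}. norm (W 0)) \<le> (\<Sum>x\<in>{0..<int N}. h x)" for N
    by (intro sum_mono)
  also have "\<dots> N \<le> infsum h UNIV" for N
    using hs by (intro finite_sum_le_infsum) (auto simp: h_def)
  finally have le: "real N * norm (W 0) \<le> infsum h UNIV" for N by simp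
  have "norm (W 0) = 0"
  proof (rule ccontr)
    assume "norm (W 0) \<noteq> 0"
    then have "norm (W 0) > 0" by simp
    from reals_Archimedean3[OF this, rule_format, of "infsum h UNIV"] show False
      using le by (meson not_le)
  qed
  then show ?thesis by (simp add: W_def)
qed

text \<open>Two consecutive values determine a solution, and the vanishing Wronskian provides c for
  which g - c f vanishes at both 0 and 1.\<close>

lemma eigenspace_one_dimensional:
  assumes f: "f \<in> eigenspace \<kappa> lam" and g: "g \<in> eigenspace \<kappa> lam" and nz: "f y \<noteq> 0"
  shows "\<exists>c. \<forall>x. g x = c * f x"
proof -
  let ?q = "\<lambda>x. complex_of_real (2 + \<kappa> ^ 4 * (real_of_int x)\<^sup>2 - lam)"
  have "f 0 \<noteq> 0 \<or> f 1 \<noteq> 0"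
    using recurrence_zero[of f ?q y] eigenspace_recurrence[OF f] nz by blast
  then obtain c where c: "g 0 = c * f 0" "g 1 = c * f 1"
  proof
    assume "f 0 \<noteq> 0"
    then show thesis using wronskian_zero[OF f g] by (intro that[of "g 0 / f 0"]) (simp_all add: field_simps)
  next
    assume "f 1 \<noteq> 0"
    then show thesis using wronskian_zero[OF f g] by (intro that[of "g 1 / f 1"]) (simp_all add: field_simps)
  qed
  define h where "h = (\<lambda>x. g x - c * f x)"
  have "h (x + 1) = ?q x * h x - h (x - 1)" for x
    unfolding h_def eigenspace_recurrence[OF f, of x] eigenspace_recurrence[OF g, of x]
    by (simp add: algebra_simps)
  then have "h x = 0" for x by (rule recurrence_zero) (use c in \<open>simp_all add: h_def\<close>)
  then show ?thesis by (auto simp: h_def)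
qed

text \<open>Of two distinct members of an independent set, one would be zero or the other
  proportional to it; either gives a nontrivial relation.\<close>

lemma multiplicity_ev_eq_1:
  assumes "is_eigenvalue \<kappa> lam"
  shows "multiplicity_ev \<kappa> lam = 1"
  unfolding multiplicity_ev_def
proof (rule cSup_eq_maximum)
  obtain f y where f: "f \<in> eigenspace \<kappa> lam" "f y \<noteq> 0"
    using assms unfolding is_eigenvalue_def by blast
  have "lin_indep {f}" unfolding lin_indep_def using f(2) by auto
  then show "1 \<in> {card S |S. S \<subseteq> eigenspace \<kappa> lam \<and> lin_indep S}"
    using f(1) by (intro CollectI exI[where x = "{f}"]) simp
next
  fix k assume "k \<in> {card S |S. S \<subseteq> eigenspace \<kappa> lam \<and> lin_indep S}"
  then obtain S where S: "k = card S" "S \<subseteq> eigenspace \<kappa> lam" "finite S"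
    and ind: "\<And>c. (\<And>x. (\<Sum>g\<in>S. c g * g x) = 0) \<Longrightarrow> \<forall>g\<in>S. c g = 0"
    unfolding lin_indep_def by blast
  show "k \<le> 1"
  proof (rule ccontr)
    assume "\<not> k \<le> 1"
    then obtain f g where fg: "f \<in> S" "g \<in> S" "f \<noteq> g"
      using S(1,3) card_le_Suc0_iff_eq[of S] by auto
    have two: "(\<Sum>h\<in>S. (if h = g then a else if h = f then b else 0) * h x) = a * g x + b * f x" for a b x
    proof -
      have "(\<Sum>h\<in>S. (if h = g then a else if h = f then b else 0) * h x)
        = (\<Sum>h\<in>{f, g}. (if h = g then a else if h = f then b else 0) * h x)"
        using fg S(3) by (intro sum.mono_neutral_right) auto
      then show ?thesis using fg(3) by simp
    qed
    show False
    proof (cases "\<exists>y. f y \<noteq> 0")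
      case True
      then obtain c where c: "\<And>x. g x = c * f x"
        using eigenspace_one_dimensional[of f \<kappa> lam g] fg S(2) by blast
      have "\<forall>h\<in>S. (if h = g then 1 else if h = f then - c else 0 :: complex) = 0"
        by (rule ind) (unfold two, simp add: c)
      from bspec[OF this fg(2)] show False by simp
    next
      case False
      have "\<forall>h\<in>S. (if h = g then 0 else if h = f then 1 else 0 :: complex) = 0"
        by (rule ind) (unfold two, use False in simp)
      from bspec[OF this fg(1)] show False using fg(3) by simp
    qed
  qed
qed

section \<open>The counting function and the limit\<close>

text \<open>By simplicity every summand is 1. For an infinite set both sides take the default value
  0, so later arguments must establish finiteness.\<close>

lemma count_ev_eq_card: "count_ev \<kappa> lam = card {\<mu>. is_eigenvalue \<kappa> \<mu> \<and> \<mu> \<le> lam}"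
  unfolding count_ev_def by (simp add: multiplicity_ev_eq_1)

text \<open>A \<open>LEAST\<close> over the reals is informative only if a minimum exists. The count
  jumps only at eigenvalues, so the minimum is sought in the finite set \<open>T\<close> of
  eigenvalues up to U.\<close>

lemma E_bounds:
  assumes fin: "finite {\<mu>. is_eigenvalue \<kappa> \<mu> \<and> \<mu> \<le> U}"
    and upper: "n < card {\<mu>. is_eigenvalue \<kappa> \<mu> \<and> \<mu> \<le> U}"
    and lower: "card {\<mu>. is_eigenvalue \<kappa> \<mu> \<and> \<mu> \<le> L} \<le> n" "L \<le> U"
  shows "L \<le> E n \<kappa>" "E n \<kappa> \<le> U"
proof -
  define S where "S = (\<lambda>lam. {\<mu>. is_eigenvalue \<kappa> \<mu> \<and> \<mu> \<le> lam})"
  have finS: "finite (S lam)" if "lam \<le> U" for lam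
    using fin by (rule rev_finite_subset) (use that in \<open>auto simp: S_def\<close>)
  \<comment> \<open>Lowering the threshold to the largest eigenvalue below it does not change the
    count.\<close>
  have maxS: "Max (S lam) \<in> S lam" "S (Max (S lam)) = S lam" if "lam \<le> U" "n < card (S lam)" for lam
  proof -
    have ne: "S lam \<noteq> {}" using that(2) by auto
    then show m: "Max (S lam) \<in> S lam" using finS[OF that(1)] by (rule Max_in[rotated])
    show "S (Max (S lam)) = S lam"
      using m Max_ge[OF finS[OF that(1)]] by (auto simp: S_def)
  qed
  define T where "T = {lam \<in> S U. n < card (S lam)}"
  have "n < card (S U)" using upper by (simp add: S_def)
  then have "Max (S U) \<in> T" unfolding T_def using maxS[of U] by simp
  moreover have finT: "finite T" unfolding T_def using finS[of U] by simp
  ultimately have t: "Min T \<in> T" by (intro Min_in) auto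
  have least: "Min T \<le> y" if "n < card (S y)" for y
  proof (cases "y \<le> U")
    case True
    have "Max (S y) \<in> T"
      unfolding T_def using maxS[OF True that] that True by (auto simp: S_def)
    then have "Min T \<le> Max (S y)" using finT by simp
    also have "\<dots> \<le> y" using maxS(1)[OF True that] by (simp add: S_def)
    finally show ?thesis .
  next
    case False
    then show ?thesis using t by (auto simp: T_def S_def)
  qed
  have Sd: "{\<mu>. is_eigenvalue \<kappa> \<mu> \<and> \<mu> \<le> lam} = S lam" for lam by (simp add: S_def)
  have "E n \<kappa> = Min T"
    unfolding E_def count_ev_eq_card Sd
    by (rule Least_equality) (use t least in \<open>auto simp: T_def\<close>)
  moreover have "Min T \<le> U" using t by (simp add: T_def S_def)
  moreover have "L \<le> Min T"
  proof (rule ccontr)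
    assume "\<not> L \<le> Min T"
    then have "card (S (Min T)) \<le> card (S L)"
      using finS[OF lower(2)] by (intro card_mono) (auto simp: S_def)
    then show False using lower(1) t by (simp add: T_def S_def)
  qed
  ultimately show "L \<le> E n \<kappa>" "E n \<kappa> \<le> U" by simp_all
qed

lemma finite_eigenvalues:
  assumes "\<kappa> > 0" "L * (1 + (2 * real n + 1) * \<kappa>\<^sup>2 / 6) < (2 * real n + 1) * \<kappa>\<^sup>2 - \<kappa> ^ 4 / 6"
  shows "finite {\<mu>. is_eigenvalue \<kappa> \<mu> \<and> \<mu> \<le> L}"
proof (rule ccontr)
  assume "infinite {\<mu>. is_eigenvalue \<kappa> \<mu> \<and> \<mu> \<le> L}"
  then obtain M where "finite M" "card M = Suc n" "M \<subseteq> {\<mu>. is_eigenvalue \<kappa> \<mu> \<and> \<mu> \<le> L}"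
    using infinite_arbitrarily_large by blast
  then show False using card_eigenvalues_le[OF assms, of M] by simp
qed

text \<open>The eigenvalues near the levels k = 0, ..., n are distinct, because each error is below
  half the spacing 2 \<kappa>^2 of the levels.\<close>

lemma card_eigenvalues_ge:
  "\<exists>C \<ge> 0. \<forall>\<^sub>F \<kappa> in at_right 0. \<exists>M. M \<subseteq> {\<mu>. is_eigenvalue \<kappa> \<mu> \<and> \<mu> \<le> ((2 * real n + 1) + C * \<kappa>) * \<kappa>\<^sup>2}
     \<and> card M = Suc n"
proof -
  obtain c d where c: "\<And>k. c k \<ge> 0" "\<And>k. d k > 0"
    "\<And>k \<kappa>. 0 < \<kappa> \<Longrightarrow> \<kappa> \<le> d k \<Longrightarrow> \<exists>\<mu>. is_eigenvalue \<kappa> \<mu> \<and> \<bar>\<mu> - (2 * real k + 1) * \<kappa>\<^sup>2\<bar> \<le> c k * \<kappa> ^ 3"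
    using eigenvalue_near_oscillator_level by metis
  define C where "C = (\<Sum>k\<le>n. c k)"
  have cC: "c k \<le> C" if "k \<le> n" for k
    unfolding C_def using that c(1) by (intro member_le_sum) auto
  have C0: "C \<ge> 0" unfolding C_def using c(1) by (intro sum_nonneg)
  \<comment> \<open>The bound 1 / (C + 1) ensures C \<kappa> < 1, hence C \<kappa>^3 < \<kappa>^2;
    the other bounds keep \<kappa> in the range valid for every level.\<close>
  define D where "D = Min (insert (1 / (C + 1)) (d ` {..n}))"
  have D: "D > 0" "D \<le> 1 / (C + 1)"
    using c(2) C0 by (auto simp: D_def)
  have Dd: "D \<le> d k" if "k \<le> n" for k
    unfolding D_def using that by (intro Min_le) auto
  have "\<exists>M. M \<subseteq> {\<mu>. is_eigenvalue \<kappa> \<mu> \<and> \<mu> \<le> ((2 * real n + 1) + C * \<kappa>) * \<kappa>\<^sup>2} \<and> card M = Suc n"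
    if \<kappa>: "0 < \<kappa>" "\<kappa> < D" for \<kappa>
  proof -
    have "\<exists>\<mu>. is_eigenvalue \<kappa> \<mu> \<and> \<bar>\<mu> - (2 * real k + 1) * \<kappa>\<^sup>2\<bar> \<le> C * \<kappa> ^ 3" if k: "k \<le> n" for k
    proof -
      have "c k * \<kappa> ^ 3 \<le> C * \<kappa> ^ 3" using cC[OF k] \<kappa> by (intro mult_right_mono) auto
      moreover obtain \<mu> where "is_eigenvalue \<kappa> \<mu>" "\<bar>\<mu> - (2 * real k + 1) * \<kappa>\<^sup>2\<bar> \<le> c k * \<kappa> ^ 3"
        using c(3)[of \<kappa> k] Dd[OF k] \<kappa> by auto
      ultimately show ?thesis by (meson order_trans)
    qed
    then obtain m where m: "\<And>k. k \<le> n \<Longrightarrow> is_eigenvalue \<kappa> (m k)"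
      "\<And>k. k \<le> n \<Longrightarrow> \<bar>m k - (2 * real k + 1) * \<kappa>\<^sup>2\<bar> \<le> C * \<kappa> ^ 3" by metis
    have "\<kappa> < 1 / (C + 1)" using \<kappa> D(2) by linarith
    then have "\<kappa> * (C + 1) < 1" using C0 by (simp add: pos_less_divide_eq)
    then have "C * \<kappa> < 1" using \<kappa>(1) by (simp add: algebra_simps)
    then have small: "C * \<kappa> ^ 3 < \<kappa>\<^sup>2"
      using mult_strict_right_mono[of "C * \<kappa>" 1 "\<kappa>\<^sup>2"] \<kappa>(1) by (simp add: power3_eq_cube power2_eq_square)
    have "inj_on m {..n}"
    proof (rule strict_mono_on_imp_inj_on, rule strict_mono_onI)
      fix j k assume jk: "j \<in> {..n}" "k \<in> {..n}" "j < k"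
      have "(2 * real j + 3) * \<kappa>\<^sup>2 \<le> (2 * real k + 1) * \<kappa>\<^sup>2"
        using jk(3) by (intro mult_right_mono) auto
      then show "m j < m k"
        using m(2)[of j] m(2)[of k] jk small by (auto simp: abs_le_iff algebra_simps)
    qed
    then have "card (m ` {..n}) = Suc n" by (simp add: card_image)
    moreover have "m k \<le> ((2 * real n + 1) + C * \<kappa>) * \<kappa>\<^sup>2" if "k \<le> n" for k
    proof -
      have "m k \<le> (2 * real k + 1) * \<kappa>\<^sup>2 + C * \<kappa> ^ 3" using m(2)[OF that] by linarith
      also have "\<dots> \<le> (2 * real n + 1) * \<kappa>\<^sup>2 + C * \<kappa> ^ 3"
        using that \<kappa>(1) by (intro add_mono mult_right_mono) auto
      finally show ?thesis by (simp add: algebra_simps power3_eq_cube power2_eq_square)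
    qed
    then have "m ` {..n} \<subseteq> {\<mu>. is_eigenvalue \<kappa> \<mu> \<and> \<mu> \<le> ((2 * real n + 1) + C * \<kappa>) * \<kappa>\<^sup>2}"
      using m(1) by auto
    ultimately show ?thesis by blast
  qed
  then have "\<forall>\<^sub>F \<kappa> in at_right 0. \<exists>M. M \<subseteq> {\<mu>. is_eigenvalue \<kappa> \<mu> \<and> \<mu> \<le> ((2 * real n + 1) + C * \<kappa>) * \<kappa>\<^sup>2}
     \<and> card M = Suc n"
    using eventually_at_right_real[OF D(1)] by (auto elim!: eventually_mono)
  then show ?thesis using C0 by blast
qed

theorem theorem2p2:
  fixes n :: nat
  shows "((\<lambda>\<kappa>. E n \<kappa> / \<kappa>\<^sup>2) \<longlongrightarrow> real (2 * n + 1)) (at_right 0)"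
proof -
  define N where "N = 2 * real n + 1"
  obtain C where C: "C \<ge> 0" and ge: "\<forall>\<^sub>F \<kappa> in at_right 0.
    \<exists>M. M \<subseteq> {\<mu>. is_eigenvalue \<kappa> \<mu> \<and> \<mu> \<le> (N + C * \<kappa>) * \<kappa>\<^sup>2} \<and> card M = Suc n"
    using card_eigenvalues_ge[of n] unfolding N_def by blast
  \<comment> \<open>The quotient is the threshold of \<open>card_eigenvalues_le\<close> divided by
    \<kappa>^2; subtracting \<kappa> makes the required inequality strict.\<close>
  define lo where "lo = (\<lambda>\<kappa>. (N - \<kappa>\<^sup>2 / 6) / (1 + N * \<kappa>\<^sup>2 / 6) - \<kappa>)"
  define hi where "hi = (\<lambda>\<kappa>. N + C * \<kappa>)"
  have N1: "N \<ge> 1" by (simp add: N_def)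
  have id0: "((\<lambda>\<kappa>::real. \<kappa>) \<longlongrightarrow> 0) (at_right 0)" by (rule tendsto_ident_at)
  have "(lo \<longlongrightarrow> (N - 0\<^sup>2 / 6) / (1 + N * 0\<^sup>2 / 6) - 0) (at_right 0)"
    unfolding lo_def by (intro tendsto_intros id0) auto
  then have lo: "(lo \<longlongrightarrow> N) (at_right 0)" by simp
  have "(hi \<longlongrightarrow> N + C * 0) (at_right 0)"
    unfolding hi_def by (intro tendsto_intros id0)
  then have hi: "(hi \<longlongrightarrow> N) (at_right 0)" by simp
  have "((\<lambda>\<kappa>. (N + 2) - \<kappa>\<^sup>2 / 6 - hi \<kappa> * (1 + (N + 2) * \<kappa>\<^sup>2 / 6)) \<longlongrightarrow>
      (N + 2) - 0\<^sup>2 / 6 - N * (1 + (N + 2) * 0\<^sup>2 / 6)) (at_right 0)"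
    by (intro tendsto_intros id0 hi) simp_all
  \<comment> \<open>This puts hi(\<kappa>) \<kappa>^2 below the threshold for n + 1, whose leading
    coefficient is N + 2, so only finitely many eigenvalues lie below it.\<close>
  then have gap: "\<forall>\<^sub>F \<kappa> in at_right 0. 0 < (N + 2) - \<kappa>\<^sup>2 / 6 - hi \<kappa> * (1 + (N + 2) * \<kappa>\<^sup>2 / 6)"
    by (rule order_tendstoD(1)) simp
  have pos: "\<forall>\<^sub>F \<kappa> in at_right (0::real). 0 < \<kappa>" by (rule eventually_at_right_less)
  have "\<forall>\<^sub>F \<kappa> in at_right 0. lo \<kappa> \<le> E n \<kappa> / \<kappa>\<^sup>2 \<and> E n \<kappa> / \<kappa>\<^sup>2 \<le> hi \<kappa>"
    using ge gap pos
  proof eventually_elim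
    case (elim \<kappa>)
    have \<kappa>2: "\<kappa>\<^sup>2 > 0" using elim(3) by simp
    have den: "1 + N * \<kappa>\<^sup>2 / 6 > 0" using N1 by (simp add: add_pos_nonneg)
    let ?S = "\<lambda>lam. {\<mu>. is_eigenvalue \<kappa> \<mu> \<and> \<mu> \<le> lam}"
    have "0 < \<kappa>\<^sup>2 * ((N + 2) - \<kappa>\<^sup>2 / 6 - hi \<kappa> * (1 + (N + 2) * \<kappa>\<^sup>2 / 6))"
      using elim(2) \<kappa>2 by simp
    then have "hi \<kappa> * \<kappa>\<^sup>2 * (1 + (2 * real (Suc n) + 1) * \<kappa>\<^sup>2 / 6) < (2 * real (Suc n) + 1) * \<kappa>\<^sup>2 - \<kappa> ^ 4 / 6"
      by (simp add: N_def algebra_simps power4_eq_xxxx power2_eq_square)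
    then have fin: "finite (?S (hi \<kappa> * \<kappa>\<^sup>2))" by (rule finite_eigenvalues[OF elim(3)])
    obtain M where M: "M \<subseteq> ?S (hi \<kappa> * \<kappa>\<^sup>2)" "card M = Suc n" using elim(1) unfolding hi_def by blast
    have up: "n < card (?S (hi \<kappa> * \<kappa>\<^sup>2))" using card_mono[OF fin M(1)] M(2) by simp
    have "lo \<kappa> * (1 + N * \<kappa>\<^sup>2 / 6) = N - \<kappa>\<^sup>2 / 6 - \<kappa> * (1 + N * \<kappa>\<^sup>2 / 6)"
      unfolding lo_def left_diff_distrib using den by simp
    then have "lo \<kappa> * (1 + N * \<kappa>\<^sup>2 / 6) < N - \<kappa>\<^sup>2 / 6" using den elim(3) by simp
    then have "\<kappa>\<^sup>2 * (lo \<kappa> * (1 + N * \<kappa>\<^sup>2 / 6)) < \<kappa>\<^sup>2 * (N - \<kappa>\<^sup>2 / 6)" using \<kappa>2 by simp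
    then have few: "lo \<kappa> * \<kappa>\<^sup>2 * (1 + (2 * real n + 1) * \<kappa>\<^sup>2 / 6) < (2 * real n + 1) * \<kappa>\<^sup>2 - \<kappa> ^ 4 / 6"
      unfolding N_def by (simp add: algebra_simps power4_eq_xxxx power2_eq_square)
    have low: "card (?S (lo \<kappa> * \<kappa>\<^sup>2)) \<le> n"
      by (rule card_eigenvalues_le[OF elim(3) few finite_eigenvalues[OF elim(3) few] order_refl])
    \<comment> \<open>The order follows from the counts: at most n eigenvalues lie up to the lower
      threshold and more than n up to the upper one.\<close>
    have "lo \<kappa> * \<kappa>\<^sup>2 \<le> hi \<kappa> * \<kappa>\<^sup>2"
    proof (rule ccontr)
      assume "\<not> ?thesis"
      then have "card (?S (hi \<kappa> * \<kappa>\<^sup>2)) \<le> card (?S (lo \<kappa> * \<kappa>\<^sup>2))"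
        using finite_eigenvalues[OF elim(3) few] by (intro card_mono) auto
      then show False using low up by simp
    qed
    then show ?case
      using E_bounds[OF fin up low] \<kappa>2 by (simp add: pos_le_divide_eq pos_divide_le_eq)
  qed
  then have "\<forall>\<^sub>F \<kappa> in at_right 0. lo \<kappa> \<le> E n \<kappa> / \<kappa>\<^sup>2" "\<forall>\<^sub>F \<kappa> in at_right 0. E n \<kappa> / \<kappa>\<^sup>2 \<le> hi \<kappa>"
    by (auto elim: eventually_mono)
  then have "((\<lambda>\<kappa>. E n \<kappa> / \<kappa>\<^sup>2) \<longlongrightarrow> N) (at_right 0)"
    using lo hi by (rule tendsto_sandwich)
  then show ?thesis by (simp add: N_def add.commute)
qed

end
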